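(* Let $A$ be a group, let $C,D$ be infinite cyclic subgroups of $A$ with an isomorphism between them, and let $G=A\ast_C=\langle A,t\mid t^{-1}Ct=D\rangle$ be the corresponding HNN extension (with stable letter $t$ conjugating $C$ onto $D$). If $G$ has the unique root property, then the abstract commensurator $\mathrm{Comm}(G)$ is not finitely generated.
   Context: A group has the unique root property if for all $x,y$ in it and every positive integer $n$, $x^n=y^n$ implies $x=y$. The abstract commensurator $\mathrm{Comm}(G)$ of a group $G$ is the group of equivalence classes of isomorphisms between finite-index subgroups of $G$, two such isomorphisms being equivalent if they agree on some finite-index subgroup of $G$ on which both are defined; the product of $\alpha:G_1\to G_1'$ and $\beta:G_2\to G_2'$ is $\alpha\beta:\alpha^{-1}(G_1'\cap G_2)\to\beta(G_1'\cap G_2)$. *)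

theory Defs
  imports "HOL-Algebra.Algebra"
begin

definition unique_roots :: "('g, 'b) monoid_scheme \<Rightarrow> bool" where
  "unique_roots G \<longleftrightarrow>
     (\<forall>x\<in>carrier G. \<forall>y\<in>carrier G. \<forall>n::nat. n > 0 \<longrightarrow>
        x [^]\<^bsub>G\<^esub> n = y [^]\<^bsub>G\<^esub> n \<longrightarrow> x = y)"

definition infinite_cyclic_subgroup :: "'a set \<Rightarrow> ('a, 'b) monoid_scheme \<Rightarrow> bool" where
  "infinite_cyclic_subgroup C A \<longleftrightarrow>
     subgroup C A \<and> infinite C \<and> (\<exists>c\<in>carrier A. C = generate A {c})"

text \<open>is_HNN A C D phi G i t: G is the HNN extension of A with stable letter t,
  t^-1 c t = phi c for c in C, i the canonical map A -> G.
  G is generated by i(A) and t, and for every group H (on a fixed type large enough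
  to contain a copy of the HNN extension), every homomorphism f from A to H and
  every s in H with s^-1 f(c) s = f(phi c) for c in C, there is a homomorphism
  from G to H extending f and sending t to s.\<close>

definition is_HNN ::
  "('a, 'b) monoid_scheme \<Rightarrow> 'a set \<Rightarrow> 'a set \<Rightarrow> ('a \<Rightarrow> 'a)
   \<Rightarrow> ('g, 'c) monoid_scheme \<Rightarrow> ('a \<Rightarrow> 'g) \<Rightarrow> 'g \<Rightarrow> bool" where
  "is_HNN A C D phi G i t \<longleftrightarrow>
     group A \<and> group G \<and> i \<in> hom A G \<and> t \<in> carrier G \<and>
     subgroup C A \<and> subgroup D A \<and>
     phi \<in> iso (A\<lparr>carrier := C\<rparr>) (A\<lparr>carrier := D\<rparr>) \<and>
     (\<forall>c\<in>C. inv\<^bsub>G\<^esub> t \<otimes>\<^bsub>G\<^esub> i c \<otimes>\<^bsub>G\<^esub> t = i (phi c)) \<and>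
     generate G (i ` carrier A \<union> {t}) = carrier G \<and>
     (\<forall>(H :: (('a \<times> int) list) monoid) f s.
        group H \<and> f \<in> hom A H \<and> s \<in> carrier H \<and>
        (\<forall>c\<in>C. inv\<^bsub>H\<^esub> s \<otimes>\<^bsub>H\<^esub> f c \<otimes>\<^bsub>H\<^esub> s = f (phi c)) \<longrightarrow>
        (\<exists>h\<in>hom G H. (\<forall>a\<in>carrier A. h (i a) = f a) \<and> h t = s))"

definition finite_index :: "('g, 'b) monoid_scheme \<Rightarrow> 'g set \<Rightarrow> bool" where
  "finite_index G H \<longleftrightarrow> subgroup H G \<and> finite (rcosets\<^bsub>G\<^esub> H)"

definition comm_isos :: "('g, 'b) monoid_scheme \<Rightarrow> ('g set \<times> ('g \<Rightarrow> 'g)) set" where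
  "comm_isos G = {(H, f). finite_index G H \<and> finite_index G (f ` H) \<and>
       f \<in> iso (G\<lparr>carrier := H\<rparr>) (G\<lparr>carrier := f ` H\<rparr>) \<and>
       (\<forall>x. x \<notin> H \<longrightarrow> f x = undefined)}"

definition comm_equiv :: "('g, 'b) monoid_scheme \<Rightarrow> (('g set \<times> ('g \<Rightarrow> 'g)) \<times> ('g set \<times> ('g \<Rightarrow> 'g))) set" where
  "comm_equiv G = {(p, q). p \<in> comm_isos G \<and> q \<in> comm_isos G \<and>
       (\<exists>K. finite_index G K \<and> K \<subseteq> fst p \<inter> fst q \<and> (\<forall>x\<in>K. snd p x = snd q x))}"

definition comm_comp :: "('g set \<times> ('g \<Rightarrow> 'g)) \<Rightarrow> ('g set \<times> ('g \<Rightarrow> 'g)) \<Rightarrow> ('g set \<times> ('g \<Rightarrow> 'g))" where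
  "comm_comp p q = (let K = {x \<in> fst p. snd p x \<in> fst q} in
                    (K, \<lambda>x. if x \<in> K then snd q (snd p x) else undefined))"

definition Comm :: "('g, 'b) monoid_scheme \<Rightarrow> ('g set \<times> ('g \<Rightarrow> 'g)) set monoid" where
  "Comm G = \<lparr> carrier = comm_isos G // comm_equiv G,
              monoid.mult = (\<lambda>U V. Image (comm_equiv G) {comm_comp (SOME p. p \<in> U) (SOME q. q \<in> V)}),
              one = Image (comm_equiv G) {(carrier G, \<lambda>x. if x \<in> carrier G then x else undefined)} \<rparr>"

definition finitely_generated_group :: "('a, 'b) monoid_scheme \<Rightarrow> bool" where
  "finitely_generated_group G \<longleftrightarrow>
     (\<exists>S. finite S \<and> S \<subseteq> carrier G \<and> generate G S = carrier G)"

end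

theory Submission
  imports Defs
begin

text \<open>Let \<open>p\<close> be a prime. Call a commensuration of \<open>G\<close> good if, extended to rational powers by unique roots, it
  maps some power \<open>g ^ k\<close> with \<open>k\<close> prime to \<open>p\<close> of each \<open>g\<close> into \<open>G\<close>. Good commensurations are closed under
  composition, and all commensurations with a domain of index less than \<open>p\<close> are good. Hence if \<open>Comm G\<close> were
  finitely generated, all commensurations would be good for large \<open>p\<close>. But the height homomorphism
  (\<open>t\<close> to 1, \<open>A\<close> to 0) taken modulo \<open>p\<close> has as kernel the group of a cycle of \<open>p\<close> conjugates of \<open>A\<close>, and the
  Dehn twist along only one of its \<open>p\<close> edges is an automorphism sending \<open>t ^ p\<close> to \<open>c t ^ p\<close>, with \<open>c\<close>
  generating \<open>C\<close>. If it were good then \<open>c t ^ p\<close> would be a \<open>p\<close>-th power in \<open>G\<close>, which the action on the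
  Bass--Serre tree together with unique roots excludes.\<close>

section \<open>HNN extensions\<close>

text \<open>Twisting all \<open>p\<close> edges equally would prove nothing: it is the restriction
  of an automorphism of \<open>G\<close> sending \<open>t\<close> to \<open>c t\<close>, and
  \<open>t ^ p\<close> would go to the \<open>p\<close>-th power \<open>(c t) ^ p\<close>.
  \<open>is_HNN\<close> offers generators and a universal property, but no normal forms and no tree.
  Cocycles replace them: a homomorphism into a wreath product over \<open>G\<close> yields a
  function on \<open>G\<close> with prescribed values on \<open>A\<close> and \<open>t\<close>, and
  such functions agree once they agree on generators. Edge counts, twists and inverse twists all
  arise in this way. The obstacle is that \<open>t\<close> may conjugate a power of \<open>c\<close>
  to another power of \<open>c\<close>, as in Baumslag-Solitar groups. The tree then determines the
  powers of a supposed \<open>p\<close>-th root only up to powers of \<open>c\<close>, and an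
  equation \<open>e (1 + r + ... + r ^ (p - 1)) = 1\<close> with rational \<open>r\<close> remains.
  For \<open>p = 2\<close> it has many solutions; for odd \<open>p\<close> and nonzero
  \<open>r\<close> it forces \<open>r = -1\<close>, the Klein bottle relation, which unique roots
  forbid.\<close>

lemma HNN_universal:
  fixes A :: "('a, 'b) monoid_scheme" and H :: "('h, 'd) monoid_scheme"
  assumes hnn: "is_HNN A C D phi G i t" and "group H"
    and f: "f \<in> hom A H" and s: "s \<in> carrier H"
    and rel: "\<And>c. c \<in> C \<Longrightarrow> f c \<otimes>\<^bsub>H\<^esub> s = s \<otimes>\<^bsub>H\<^esub> f (phi c)"
  obtains h where "h \<in> hom G H" "\<And>a. a \<in> carrier A \<Longrightarrow> h (i a) = f a" "h t = s"
proof -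
  interpret H: group H by fact
  interpret A: group A using hnn by (simp add: is_HNN_def)
  interpret f: group_hom A H f by unfold_locales (rule f)
  define S where "S = generate H (f ` carrier A \<union> {s})"
  \<comment> \<open>The defining property covers only groups whose elements are lists over
    \<open>'a \<times> int\<close>. The subgroup \<open>S\<close> fits there: each element is the
    value of a word in syllables \<open>f a s ^ n\<close>, and one chosen word per element serves as
    its name.\<close>
  define W :: "('a \<times> int) list set" where "W = lists (carrier A \<times> UNIV)"
  define ev where "ev = (\<lambda>w::('a \<times> int) list. foldr (\<lambda>(a, n) x. f a \<otimes>\<^bsub>H\<^esub> (s [^]\<^bsub>H\<^esub> n \<otimes>\<^bsub>H\<^esub> x)) w \<one>\<^bsub>H\<^esub>)"
  have ev_Nil: "ev [] = \<one>\<^bsub>H\<^esub>" and ev_Cons: "ev ((a, n) # w) = f a \<otimes>\<^bsub>H\<^esub> (s [^]\<^bsub>H\<^esub> n \<otimes>\<^bsub>H\<^esub> ev w)" for a n w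
    by (simp_all add: ev_def)
  have ev_closed: "ev w \<in> carrier H" if "w \<in> W" for w
    using that s unfolding W_def by induction (auto simp: ev_Nil ev_Cons)
  have ev_append: "ev (v @ w) = ev v \<otimes>\<^bsub>H\<^esub> ev w" if "v \<in> W" "w \<in> W" for v w
    using that(1) unfolding W_def
  proof induction
    case (Cons x v)
    obtain a n where x: "x = (a, n)" by (cases x)
    have "ev v \<in> carrier H" "ev w \<in> carrier H" "f a \<in> carrier H"
      using ev_closed[of v] ev_closed[of w] Cons that x by (auto simp: W_def)
    then show ?case
      using Cons s x by (simp add: ev_Cons H.m_assoc)
  qed (use ev_closed that in \<open>simp add: ev_Nil\<close>)
  have gens: "f ` carrier A \<union> {s} \<subseteq> carrier H" using s by auto
  have sub: "subgroup S H"
    unfolding S_def by (rule H.generate_is_subgroup[OF gens])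
  have S_ev: "S \<subseteq> ev ` W"
  proof
    fix x assume "x \<in> S"
    then show "x \<in> ev ` W"
      unfolding S_def
    proof (induction rule: generate.induct)
      case one
      show ?case using ev_Nil by (intro image_eqI[of _ _ "[]"]) (auto simp: W_def)
    next
      case (incl h)
      then consider a where "a \<in> carrier A" "h = f a" | "h = s" by auto
      then show ?case
      proof cases
        case 1
        then show ?thesis
          by (intro image_eqI[of _ _ "[(a, 0)]"]) (auto simp: W_def ev_Nil ev_Cons)
      next
        case 2
        then show ?thesis
          using s by (intro image_eqI[of _ _ "[(\<one>\<^bsub>A\<^esub>, 1)]"]) (auto simp: W_def ev_Nil ev_Cons)
      qed
    next
      case (inv h)
      then consider a where "a \<in> carrier A" "h = f a" | "h = s" by auto
      then show ?case
      proof cases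
        case 1
        then show ?thesis
          by (intro image_eqI[of _ _ "[(inv\<^bsub>A\<^esub> a, 0)]"]) (auto simp: W_def ev_Nil ev_Cons)
      next
        case 2
        then show ?thesis
          using s by (intro image_eqI[of _ _ "[(\<one>\<^bsub>A\<^esub>, -1)]"])
            (auto simp: W_def ev_Nil ev_Cons H.int_pow_neg)
      qed
    next
      case (eng x y)
      then obtain v w where "v \<in> W" "w \<in> W" "x = ev v" "y = ev w" by auto
      then show ?case
        using ev_append by (intro image_eqI[of _ _ "v @ w"]) (auto simp: W_def)
    qed
  qed
  define code where "code = inv_into W ev"
  have ev_code: "ev (code x) = x" if "x \<in> S" for x
    unfolding code_def by (rule f_inv_into_f) (use S_ev that in blast)
  define L where "L = \<lparr>carrier = code ` S, monoid.mult = \<lambda>x y. code (ev x \<otimes>\<^bsub>H\<^esub> ev y), one = code \<one>\<^bsub>H\<^esub>\<rparr>"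
  interpret K: group "H\<lparr>carrier := S\<rparr>"
    by (rule H.subgroup_imp_group[OF sub])
  have "inj_on code S" by (metis ev_code inj_onI)
  then have "code \<in> iso (H\<lparr>carrier := S\<rparr>) L"
    using ev_code by (auto simp: iso_def hom_def L_def bij_betw_def)
  from K.iso_imp_img_group[OF this] have L: "group L" by (simp add: L_def)
  then interpret L: group L .
  have fS: "f a \<in> S" if "a \<in> carrier A" for a
    using that by (auto simp: S_def intro: generate.incl)
  have code_f: "code \<circ> f \<in> hom A L"
    using ev_code fS by (auto simp: hom_def L_def)
  have sS: "s \<in> S" by (auto simp: S_def intro: generate.incl)
  have C: "subgroup C A" and D: "subgroup D A" and "phi \<in> iso (A\<lparr>carrier := C\<rparr>) (A\<lparr>carrier := D\<rparr>)"
    using hnn by (auto simp: is_HNN_def)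
  then have phi: "phi c \<in> carrier A" if "c \<in> C" for c
    using that subgroup.mem_carrier[OF D] by (auto simp: iso_def hom_def)
  have "inv\<^bsub>L\<^esub> (code s) \<otimes>\<^bsub>L\<^esub> code (f c) \<otimes>\<^bsub>L\<^esub> code s = code (f (phi c))" if c: "c \<in> C" for c
  proof -
    have cA: "c \<in> carrier A" using c subgroup.mem_carrier[OF C] by auto
    have mem: "code s \<in> carrier L" "code (f c) \<in> carrier L" "code (f (phi c)) \<in> carrier L"
      using sS fS[OF cA] fS[OF phi[OF c]] by (auto simp: L_def)
    moreover have "code (f c) \<otimes>\<^bsub>L\<^esub> code s = code s \<otimes>\<^bsub>L\<^esub> code (f (phi c))"
      using sS fS[OF cA] fS[OF phi[OF c]] rel[OF c] by (simp add: L_def ev_code)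
    ultimately show ?thesis
      by (metis L.inv_closed L.m_assoc L.l_inv L.l_one)
  qed
  then have "\<exists>h\<in>hom G L. (\<forall>a\<in>carrier A. h (i a) = (code \<circ> f) a) \<and> h t = code s"
    using hnn[unfolded is_HNN_def, THEN conjunct2, THEN conjunct2, THEN conjunct2, THEN conjunct2,
        THEN conjunct2, THEN conjunct2, THEN conjunct2, THEN conjunct2, THEN conjunct2,
        rule_format, of L "code \<circ> f" "code s"] L code_f sS
    by (simp add: L_def)
  then obtain h where h: "h \<in> hom G L" "\<And>a. a \<in> carrier A \<Longrightarrow> h (i a) = code (f a)" "h t = code s"
    by auto
  have "ev \<circ> h \<in> hom G H"
  proof (rule homI)
    fix x y assume xy: "x \<in> carrier G" "y \<in> carrier G"
    then have "h x \<in> code ` S" "h y \<in> code ` S"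
      using hom_in_carrier[OF h(1)] by (auto simp: L_def)
    then show "(ev \<circ> h) x \<in> carrier H" "(ev \<circ> h) (x \<otimes>\<^bsub>G\<^esub> y) = (ev \<circ> h) x \<otimes>\<^bsub>H\<^esub> (ev \<circ> h) y"
      using ev_code subgroup.subset[OF sub] hom_mult[OF h(1) xy] subgroup.m_closed[OF sub]
      by (auto simp: L_def)
  qed
  moreover have "(ev \<circ> h) (i a) = f a" if "a \<in> carrier A" for a
    using h(2)[OF that] ev_code fS[OF that] by simp
  moreover have "(ev \<circ> h) t = s"
    using h(3) ev_code sS by simp
  ultimately show thesis using that by blast
qed

text \<open>The unrestricted permutational wreath product of \<open>K\<close> by \<open>G\<close>
  for the right action \<open>act\<close>. A homomorphism from \<open>G\<close> with identity second
  component is the same thing as a cocycle,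
  \<open>z x (g h) = z x g * z (act x g) h\<close>.\<close>

definition twisted_product ::
    "('x \<Rightarrow> 'g \<Rightarrow> 'x) \<Rightarrow> ('k, 'd) monoid_scheme \<Rightarrow> ('g, 'c) monoid_scheme \<Rightarrow> (('x \<Rightarrow> 'k) \<times> 'g) monoid" where
  "twisted_product act K G =
     \<lparr>carrier = {F. \<forall>x. F x \<in> carrier K} \<times> carrier G,
      monoid.mult = \<lambda>p q. (\<lambda>x. fst p x \<otimes>\<^bsub>K\<^esub> fst q (act x (snd p)), snd p \<otimes>\<^bsub>G\<^esub> snd q),
      one = (\<lambda>x. \<one>\<^bsub>K\<^esub>, \<one>\<^bsub>G\<^esub>)\<rparr>"

lemma twisted_product_simps:
  "p \<in> carrier (twisted_product act K G) \<longleftrightarrow> (\<forall>x. fst p x \<in> carrier K) \<and> snd p \<in> carrier G"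
  "p \<otimes>\<^bsub>twisted_product act K G\<^esub> q = (\<lambda>x. fst p x \<otimes>\<^bsub>K\<^esub> fst q (act x (snd p)), snd p \<otimes>\<^bsub>G\<^esub> snd q)"
  "\<one>\<^bsub>twisted_product act K G\<^esub> = (\<lambda>x. \<one>\<^bsub>K\<^esub>, \<one>\<^bsub>G\<^esub>)"
  by (auto simp: twisted_product_def mem_Times_iff)

lemma group_twisted_product:
  assumes "group K" "group G"
    and one: "\<And>x. act x \<one>\<^bsub>G\<^esub> = x"
    and mult: "\<And>x g h. g \<in> carrier G \<Longrightarrow> h \<in> carrier G \<Longrightarrow> act x (g \<otimes>\<^bsub>G\<^esub> h) = act (act x g) h"
  shows "group (twisted_product act K G)"
proof -
  interpret K: group K by fact
  interpret G: group G by fact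
  show ?thesis
  proof (rule groupI)
    fix p assume "p \<in> carrier (twisted_product act K G)"
    then have p: "\<And>x. fst p x \<in> carrier K" "snd p \<in> carrier G"
      by (auto simp: twisted_product_simps)
    show "\<exists>q\<in>carrier (twisted_product act K G). q \<otimes>\<^bsub>twisted_product act K G\<^esub> p = \<one>\<^bsub>twisted_product act K G\<^esub>"
      by (rule bexI[of _ "(\<lambda>x. inv\<^bsub>K\<^esub> fst p (act x (inv\<^bsub>G\<^esub> snd p)), inv\<^bsub>G\<^esub> snd p)"])
        (simp_all add: twisted_product_simps p)
  qed (simp_all add: twisted_product_simps one mult K.m_assoc G.m_assoc)
qed

text \<open>The homomorphism into the twisted product has the identity as second component, because this
  holds on generators; its first component is then a cocycle with prescribed values on generators.\<close>

lemma HNN_cocycle: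
  assumes hnn: "is_HNN A C D phi G i t" and K: "group K"
    and one: "\<And>x. act x \<one>\<^bsub>G\<^esub> = x"
    and mult: "\<And>x g h. g \<in> carrier G \<Longrightarrow> h \<in> carrier G \<Longrightarrow> act x (g \<otimes>\<^bsub>G\<^esub> h) = act (act x g) h"
    and r: "\<And>x a. a \<in> carrier A \<Longrightarrow> r x a \<in> carrier K"
    and r_mult: "\<And>x a b. a \<in> carrier A \<Longrightarrow> b \<in> carrier A \<Longrightarrow>
                   r x (a \<otimes>\<^bsub>A\<^esub> b) = r x a \<otimes>\<^bsub>K\<^esub> r (act x (i a)) b"
    and s: "\<And>x. s x \<in> carrier K"
    and rel: "\<And>x c. c \<in> C \<Longrightarrow> r x c \<otimes>\<^bsub>K\<^esub> s (act x (i c)) = s x \<otimes>\<^bsub>K\<^esub> r (act x t) (phi c)"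
  obtains z where "\<And>x g. g \<in> carrier G \<Longrightarrow> z x g \<in> carrier K"
    and "\<And>x g h. g \<in> carrier G \<Longrightarrow> h \<in> carrier G \<Longrightarrow> z x (g \<otimes>\<^bsub>G\<^esub> h) = z x g \<otimes>\<^bsub>K\<^esub> z (act x g) h"
    and "\<And>x a. a \<in> carrier A \<Longrightarrow> z x (i a) = r x a" and "\<And>x. z x t = s x"
proof -
  let ?H = "twisted_product act K G"
  interpret G: group G using hnn by (simp add: is_HNN_def)
  have H: "group ?H"
    using group_twisted_product[of K G act] K one mult G.group_axioms by blast
  have i: "i \<in> hom A G" and t: "t \<in> carrier G" and C: "subgroup C A"
    and gen: "generate G (i ` carrier A \<union> {t}) = carrier G"
    and conj: "\<And>c. c \<in> C \<Longrightarrow> inv\<^bsub>G\<^esub> t \<otimes>\<^bsub>G\<^esub> i c \<otimes>\<^bsub>G\<^esub> t = i (phi c)"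
    using hnn by (auto simp: is_HNN_def)
  have iG: "i a \<in> carrier G" if "a \<in> carrier A" for a
    using i that by (rule hom_in_carrier)
  have f: "(\<lambda>a. (\<lambda>x. r x a, i a)) \<in> hom A ?H"
    using r r_mult iG by (auto simp: hom_def twisted_product_simps hom_mult[OF i])
  have "i c \<otimes>\<^bsub>G\<^esub> t = t \<otimes>\<^bsub>G\<^esub> i (phi c)" if "c \<in> C" for c
    using conj[OF that] t iG[OF subgroup.mem_carrier[OF C that]]
    by (metis G.inv_solve_left G.m_assoc G.m_closed G.inv_closed)
  then obtain h where h: "h \<in> hom G ?H" "\<And>a. a \<in> carrier A \<Longrightarrow> h (i a) = (\<lambda>x. r x a, i a)" "h t = (s, t)"
    using HNN_universal[OF hnn H f, of "(s, t)"] s t rel by (auto simp: twisted_product_simps)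
  interpret h: group_hom G ?H h
    using H h(1) by (simp add: group_hom_def group_hom_axioms_def G.group_axioms)
  have snd: "(snd \<circ> h) \<in> hom G G"
    using h.hom_closed by (auto simp: hom_def twisted_product_simps)
  then interpret snd: group_hom G G "snd \<circ> h"
    by (simp add: group_hom_def group_hom_axioms_def G.group_axioms)
  have snd_h: "snd (h g) = g" if "g \<in> carrier G" for g
  proof -
    have "g \<in> generate G (i ` carrier A \<union> {t})" using gen that by simp
    then have "g \<in> carrier G \<and> (snd \<circ> h) g = g"
    proof induction
      case (inv x)
      then have "x \<in> carrier G" "(snd \<circ> h) x = x" using iG t h by auto
      then show ?case by (metis G.inv_closed snd.hom_inv)
    next
      case (eng x y)
      then show ?case by (metis G.m_closed snd.hom_mult)
    next
      case one
      then show ?case using snd.hom_one by simp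
    qed (use iG t h in auto)
    then show ?thesis by simp
  qed
  show thesis
  proof (rule that[of "\<lambda>x g. fst (h g) x"])
    show "fst (h g) x \<in> carrier K" if "g \<in> carrier G" for x g
      using h.hom_closed[OF that] by (simp add: twisted_product_simps)
    show "fst (h (g \<otimes>\<^bsub>G\<^esub> g')) x = fst (h g) x \<otimes>\<^bsub>K\<^esub> fst (h g') (act x g)"
      if "g \<in> carrier G" "g' \<in> carrier G" for x g g'
      using h.hom_mult[OF that] snd_h[OF that(1)] by (simp add: twisted_product_simps)
  qed (simp_all add: h)
qed

section \<open>Injectivity of the base group\<close>

lemma (in group) right_transversal:
  assumes H: "subgroup H G"
  obtains T where "T \<subseteq> carrier G" "T \<noteq> {}" "bij_betw (\<lambda>(h, x). h \<otimes> x) (H \<times> T) (carrier G)"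
proof -
  interpret H: subgroup H G by fact
  define rep where "rep R = (SOME x. x \<in> R)" for R :: "'a set"
  have rep: "rep R \<in> R" if "R \<in> rcosets H" for R
    unfolding rep_def using H.rcosets_non_empty[OF that] by (simp add: some_in_eq)
  have repr: "rep (H #> x) \<in> carrier G" "H #> rep (H #> x) = H #> x" if x: "x \<in> carrier G" for x
  proof -
    have "rep (H #> x) \<in> H #> x" using rep rcosetsI[OF H.subset x] .
    then show "rep (H #> x) \<in> carrier G" "H #> rep (H #> x) = H #> x"
      using x H r_coset_subset_G[OF H.subset x] repr_independence[of "rep (H #> x)" H x] by auto
  qed
  define T where "T = rep ` (rcosets H)"
  have T: "x \<in> carrier G" "rep (H #> x) = x" if "x \<in> T" for x
    using that repr by (auto simp: T_def RCOSETS_def)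
  have "inj_on (\<lambda>(h, x). h \<otimes> x) (H \<times> T)"
  proof (rule inj_onI, clarsimp)
    fix h x h' x' assume *: "h \<in> H" "x \<in> T" "h' \<in> H" "x' \<in> T" "h \<otimes> x = h' \<otimes> x'"
    have "H #> x = H #> (h \<otimes> x)" "H #> x' = H #> (h' \<otimes> x')"
      using * T(1) by (metis H.mem_carrier H.rcos_const coset_mult_assoc H.subset is_group)+
    then have "x = x'" using * T(2) by metis
    then show "h = h' \<and> x = x'" using * T(1) by simp
  qed
  moreover have "(\<lambda>(h, x). h \<otimes> x) ` (H \<times> T) = carrier G"
  proof
    show "carrier G \<subseteq> (\<lambda>(h, x). h \<otimes> x) ` (H \<times> T)"
    proof
      fix x assume x: "x \<in> carrier G"
      then have "x \<in> H #> rep (H #> x)" using repr(2)[OF x] rcos_self[OF x H] by simp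
      then show "x \<in> (\<lambda>(h, x). h \<otimes> x) ` (H \<times> T)"
        using x rcosetsI[OF H.subset x] by (force simp: r_coset_def T_def)
    qed
  qed (use T in auto)
  moreover have "T \<subseteq> carrier G" using T(1) by blast
  moreover have "T \<noteq> {}" using H.subgroup_in_rcosets[OF is_group] by (auto simp: T_def)
  ultimately show thesis using that by (simp add: bij_betw_def)
qed

text \<open>Both products have the cardinality of \<open>A\<close>, so transversals of different
  sizes can be matched.\<close>

lemma bij_betw_Times_infinite_subset:
  assumes "infinite A" "S \<subseteq> A" "S \<noteq> {}" "T \<subseteq> A" "T \<noteq> {}"
  obtains b where "bij_betw b (S \<times> A) (T \<times> A)"
proof -
  have "|A \<times> S| =o |A|" "|A \<times> T| =o |A|"
    using assms by (simp_all add: card_of_Times_infinite card_of_mono1)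
  then have "|S \<times> A| =o |T \<times> A|"
    by (rule ordIso_transitive[OF ordIso_transitive[OF card_of_Times_commute]
          ordIso_transitive[OF ordIso_symmetric card_of_Times_commute]])
  then show thesis using that card_of_ordIso[of "S \<times> A" "T \<times> A"] by auto
qed

definition perm_group :: "('x \<Rightarrow> 'x) monoid" where
  "perm_group = \<lparr>carrier = {f. bij f}, monoid.mult = (\<circ>), one = id\<rparr>"

lemma group_perm_group: "group perm_group"
proof (rule groupI)
  fix f :: "'x \<Rightarrow> 'x" assume "f \<in> carrier perm_group"
  then show "\<exists>g\<in>carrier perm_group. g \<otimes>\<^bsub>perm_group\<^esub> f = \<one>\<^bsub>perm_group\<^esub>"
    by (intro bexI[of _ "inv_into UNIV f"])
      (auto simp: perm_group_def bij_imp_bij_inv bij_is_inj)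
qed (auto simp: perm_group_def bij_comp o_assoc)

lemma bij_extend_by_id:
  assumes "bij_betw f Y Y"
  shows "bij (\<lambda>x. if x \<in> Y then f x else x)"
  using bij_betw_disjoint_Un[of f Y Y "\<lambda>x. x" "- Y" "- Y"] assms by (simp add: bij_betw_def)

text \<open>\<^term>\<open>A\<close> acts on \<^term>\<open>carrier A \<times> carrier A\<close> by left multiplication in the first factor.
  Since the second factor makes the numbers of orbits of \<^term>\<open>C\<close> and of \<^term>\<open>D\<close> equal, some
  permutation conjugates the action of \<^term>\<open>C\<close> to that of \<^term>\<open>D\<close>.\<close>

lemma HNN_base_injective:
  assumes hnn: "is_HNN A C D phi G i t" and inf: "infinite (carrier A)"
    and a: "a \<in> carrier A" "i a = \<one>\<^bsub>G\<^esub>"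
  shows "a = \<one>\<^bsub>A\<^esub>"
proof -
  interpret A: group A using hnn by (simp add: is_HNN_def)
  interpret G: group G using hnn by (simp add: is_HNN_def)
  have C: "subgroup C A" and D: "subgroup D A" and phi: "phi \<in> iso (A\<lparr>carrier := C\<rparr>) (A\<lparr>carrier := D\<rparr>)"
    using hnn by (auto simp: is_HNN_def)
  interpret C: subgroup C A by fact
  interpret D: subgroup D A by fact
  have phi_bij: "bij_betw phi C D" and phi_mult: "\<And>x y. x \<in> C \<Longrightarrow> y \<in> C \<Longrightarrow> phi (x \<otimes>\<^bsub>A\<^esub> y) = phi x \<otimes>\<^bsub>A\<^esub> phi y"
    using phi by (auto simp: iso_def hom_def)
  obtain S where S: "S \<subseteq> carrier A" "S \<noteq> {}" "bij_betw (\<lambda>(h, x). h \<otimes>\<^bsub>A\<^esub> x) (C \<times> S) (carrier A)"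
    using A.right_transversal[OF C] by blast
  obtain T where T: "T \<subseteq> carrier A" "T \<noteq> {}" "bij_betw (\<lambda>(h, x). h \<otimes>\<^bsub>A\<^esub> x) (D \<times> T) (carrier A)"
    using A.right_transversal[OF D] by blast
  obtain b where b: "bij_betw b (S \<times> carrier A) (T \<times> carrier A)"
    using bij_betw_Times_infinite_subset[OF inf S(1,2) T(1,2)] by blast
  let ?X = "carrier A \<times> carrier A"
  define k where "k = (\<lambda>(h, x, y::'a). (h \<otimes>\<^bsub>A\<^esub> x, y))"
  have k_bij: "bij_betw k (H \<times> U \<times> carrier A) ?X"
    if "bij_betw (\<lambda>(h, x). h \<otimes>\<^bsub>A\<^esub> x) (H \<times> U) (carrier A)" for H U
    using that by (fastforce simp: bij_betw_def inj_on_def k_def image_iff)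
  have k_mult: "k (g \<otimes>\<^bsub>A\<^esub> h, x, y) = (g \<otimes>\<^bsub>A\<^esub> fst (k (h, x, y)), snd (k (h, x, y)))"
    if "g \<in> carrier A" "h \<in> carrier A" "x \<in> carrier A" for g h x y
    using that by (simp add: k_def A.m_assoc)
  \<comment> \<open>The coordinates \<open>k\<close> present the set as
    \<open>C \<times> S \<times> carrier A\<close> and as
    \<open>D \<times> T \<times> carrier A\<close>, with \<open>C\<close> and \<open>D\<close>
    acting on the first factor alone. Inverting \<open>phi\<close> there, with any bijection of the
    rest, intertwines the two actions.\<close>
  define s where "s = k \<circ> map_prod (inv_into C phi) (inv_into (S \<times> carrier A) b) \<circ> inv_into (D \<times> T \<times> carrier A) k"
  have bij_inv: "bij_betw (map_prod (inv_into C phi) (inv_into (S \<times> carrier A) b)) (D \<times> T \<times> carrier A) (C \<times> S \<times> carrier A)"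
    using bij_betw_inv_into[OF phi_bij] bij_betw_inv_into[OF b]
    by (simp add: bij_betw_def map_prod_inj_on map_prod_surj_on)
  have s_bij: "bij_betw s ?X ?X"
    unfolding s_def o_assoc[symmetric]
    by (rule bij_betw_trans[OF bij_betw_trans[OF bij_betw_inv_into[OF k_bij[OF T(3)]] bij_inv] k_bij[OF S(3)]])
  have s_equiv: "s (phi c \<otimes>\<^bsub>A\<^esub> x, y) = (c \<otimes>\<^bsub>A\<^esub> fst (s (x, y)), snd (s (x, y)))"
    if c: "c \<in> C" and xy: "x \<in> carrier A" "y \<in> carrier A" for c x y
  proof -
    have "(x, y) \<in> k ` (D \<times> T \<times> carrier A)"
      using k_bij[OF T(3)] xy by (simp add: bij_betw_def)
    then obtain d q z where d: "d \<in> D" "q \<in> T" "z \<in> carrier A" "(x, y) = k (d, q, z)" by blast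
    have inv_k: "inv_into (D \<times> T \<times> carrier A) k (k (d', q, z)) = (d', q, z)" if "d' \<in> D" for d'
      using k_bij[OF T(3)] d that by (intro inv_into_f_f) (auto simp: bij_betw_def)
    obtain c' where c': "c' \<in> C" "d = phi c'"
      using phi_bij d by (auto simp: bij_betw_def)
    have pc: "phi c \<in> D" using phi_bij c by (auto simp: bij_betw_def)
    have inv_phi: "inv_into C phi (phi e) = e" if "e \<in> C" for e
      using phi_bij that by (intro inv_into_f_f) (auto simp: bij_betw_def)
    obtain q' z' where q': "inv_into (S \<times> carrier A) b (q, z) = (q', z')" "q' \<in> S"
      using bij_betw_apply[OF bij_betw_inv_into[OF b], of "(q, z)"] d by (auto simp: mem_Times_iff prod_eq_iff)
    have "(phi c \<otimes>\<^bsub>A\<^esub> x, y) = k (phi c \<otimes>\<^bsub>A\<^esub> d, q, z)"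
      using d pc T(1) k_mult[of "phi c" d q z] by (metis D.mem_carrier fst_conv snd_conv subsetD)
    then have "s (phi c \<otimes>\<^bsub>A\<^esub> x, y) = k (c \<otimes>\<^bsub>A\<^esub> c', q', z')"
      using c c' pc d inv_k[of "phi c \<otimes>\<^bsub>A\<^esub> d"] inv_phi[of "c \<otimes>\<^bsub>A\<^esub> c'"] phi_mult[of c c'] q'
      by (simp add: s_def)
    moreover have "s (x, y) = k (c', q', z')"
      using d inv_k inv_phi c' q' by (simp add: s_def)
    ultimately show ?thesis
      using k_mult[of c c' q' z'] c c' q' S(1) by auto
  qed
  \<comment> \<open>Both maps are the identity off \<open>?X\<close>, since
    \<open>perm_group\<close> consists of permutations of the whole type.\<close>
  define f where "f a = (\<lambda>p. if p \<in> ?X then (a \<otimes>\<^bsub>A\<^esub> fst p, snd p) else p)" for a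
  define s' where "s' = (\<lambda>p. if p \<in> ?X then s p else p)"
  have f_mult: "f (x \<otimes>\<^bsub>A\<^esub> y) = f x \<circ> f y" if "x \<in> carrier A" "y \<in> carrier A" for x y
    using that by (auto simp: f_def fun_eq_iff A.m_assoc)
  have f_one: "f \<one>\<^bsub>A\<^esub> = id"
    by (auto simp: f_def fun_eq_iff)
  have f_bij: "bij (f x)" if "x \<in> carrier A" for x
    using that f_mult[of x "inv\<^bsub>A\<^esub> x"] f_mult[of "inv\<^bsub>A\<^esub> x" x] f_one
    by (intro o_bij[of "f (inv\<^bsub>A\<^esub> x)"]) simp_all
  have f: "f \<in> hom A perm_group"
    using f_mult f_bij by (auto simp: hom_def perm_group_def)
  have s': "s' \<in> carrier perm_group"
    using bij_extend_by_id[OF s_bij] by (simp add: perm_group_def s'_def)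
  have "f c \<otimes>\<^bsub>perm_group\<^esub> s' = s' \<otimes>\<^bsub>perm_group\<^esub> f (phi c)" if c: "c \<in> C" for c
  proof -
    have "phi c \<in> carrier A" using phi_bij c by (auto simp: bij_betw_def)
    moreover have "s p \<in> ?X" if "p \<in> ?X" for p using s_bij that by (auto simp: bij_betw_def)
    ultimately show ?thesis
      using s_equiv[OF c] by (auto simp: perm_group_def f_def s'_def fun_eq_iff)
  qed
  then obtain h where h: "h \<in> hom G perm_group" "\<And>a. a \<in> carrier A \<Longrightarrow> h (i a) = f a"
    using HNN_universal[OF hnn group_perm_group f s'] by blast
  have "f a = id"
    using h(2)[OF a(1)] a(2) hom_one[OF h(1) G.group_axioms group_perm_group] by (simp add: perm_group_def)
  then have "f a (\<one>\<^bsub>A\<^esub>, \<one>\<^bsub>A\<^esub>) = (\<one>\<^bsub>A\<^esub>, \<one>\<^bsub>A\<^esub>)" by simp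
  then show ?thesis using a by (simp add: f_def)
qed

section \<open>Roots of twisted translations\<close>

text \<open>The function \<open>z ^ p - z = z * (z ^ (p - 1) - 1)\<close> is strictly increasing on
  positive integers.\<close>

lemma power_diff_eq_diff_imp_eq:
  fixes x y :: int
  assumes "1 \<le> x" "1 \<le> y" "1 < p" and eq: "\<bar>x ^ p - y ^ p\<bar> = \<bar>x - y\<bar>"
  shows "x = y"
proof -
  have less: "v - u < v ^ p - u ^ p" if "1 \<le> u" "u < v" for u v :: int
  proof -
    obtain k where p: "p = Suc k" "k > 0" using \<open>1 < p\<close> by (cases p) auto
    have "u ^ k < v ^ k" "1 \<le> u ^ k" using that p by (simp_all add: power_strict_mono)
    then have "u * (u ^ k - 1) < v * (v ^ k - 1)"
      using that by (intro mult_strict_mono') auto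
    then show ?thesis using p by (simp add: algebra_simps)
  qed
  show ?thesis
    using less[of x y] less[of y x] assms by (cases x y rule: linorder_cases) auto
qed

lemma power_sum_eq_sum_imp_one:
  fixes x y :: int
  assumes "1 \<le> x" "1 \<le> y" "1 < p" "x ^ p + y ^ p = x + y"
  shows "x = 1" "y = 1"
proof -
  have less: "z < z ^ p" if "1 < z" for z :: int
    using power_strict_increasing[of 1 p z] that assms by simp
  have "x \<le> x ^ p" "y \<le> y ^ p" using assms by (simp_all add: self_le_power)
  then show "x = 1" "y = 1"
    using less[of x] less[of y] assms by linarith+
qed

text \<open>For equal signs, strict growth of \<open>z ^ p - z\<close> forces \<open>a = b\<close>,
  which is excluded. For opposite signs, oddness of \<open>p\<close> turns both differences into
  sums of absolute values, and only absolute value one survives.\<close>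

lemma abs_power_diff_eq_abs_diff:
  fixes a b :: int
  assumes "odd p" "1 < p" "a \<noteq> 0" "b \<noteq> 0" "a \<noteq> b" and eq: "\<bar>b ^ p - a ^ p\<bar> = \<bar>b - a\<bar>"
  shows "b = - a"
proof -
  consider "a > 0" "b > 0" | "a < 0" "b < 0" | "a > 0" "b < 0" | "a < 0" "b > 0"
    using assms by linarith
  then show ?thesis
  proof cases
    case 1
    then show ?thesis using power_diff_eq_diff_imp_eq[of b a p] assms by auto
  next
    case 2
    then have "- b = - a"
      using assms by (intro power_diff_eq_diff_imp_eq[of "- b" "- a" p]) auto
    then show ?thesis using assms by simp
  next
    case 3
    then have "a ^ p > 0" "b ^ p < 0" using assms by auto
    moreover have "(- b) ^ p = - (b ^ p)" using \<open>odd p\<close> by simp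
    ultimately have "a ^ p + (- b) ^ p = a + (- b)" using 3 eq by linarith
    then show ?thesis using power_sum_eq_sum_imp_one[of a "- b" p] 3 assms by simp
  next
    case 4
    then have "a ^ p < 0" "b ^ p > 0" using assms by auto
    moreover have "(- a) ^ p = - (a ^ p)" using \<open>odd p\<close> by simp
    ultimately have "b ^ p + (- a) ^ p = b + (- a)" using 4 eq by linarith
    then show ?thesis using power_sum_eq_sum_imp_one[of b "- a" p] 4 assms by simp
  qed
qed

text \<open>With \<open>r = f / e\<close> the hypotheses say \<open>e (1 + r + \<dots> + r ^ (p - 1)) = 1\<close>; for \<open>r = b / a\<close> in lowest
  terms this forces \<open>(b ^ p - a ^ p) / (b - a) = \<plusminus>1\<close>.\<close>

lemma geometric_sum_recurrence:
  fixes e f :: int and g :: "nat \<Rightarrow> int"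
  assumes "e \<noteq> 0" "f \<noteq> 0" "odd p" "1 < p" "g 0 = 0" "g p = 1"
    and rec: "\<And>m. m < p \<Longrightarrow> f * g m = e * (g (Suc m) - e)"
  shows "f = - e"
proof -
  define d where "d = gcd e f"
  obtain a b where ab: "e = d * a" "f = d * b" "coprime a b"
    using gcd_coprime_exists[of e f] assms(1) unfolding d_def by (metis gcd_eq_0_iff mult.commute)
  have nz: "d \<noteq> 0" "a \<noteq> 0" "b \<noteq> 0" using ab assms by auto
  have rec': "g (Suc m) * a = b * g m + e * a" if "m < p" for m
  proof -
    have "d * (b * g m) = d * (a * (g (Suc m) - e))"
      using rec[OF that] ab(1,2) by (metis mult.assoc)
    then have "b * g m = a * (g (Suc m) - e)" using nz by simp
    then show ?thesis by (simp add: algebra_simps)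
  qed
  \<comment> \<open>With ratio one the sum would be \<open>p * e\<close>, which cannot equal
    1.\<close>
  have "a \<noteq> b"
  proof
    assume "a = b"
    have "g m = int m * e" if "m \<le> p" for m
      using that
    proof (induction m)
      case (Suc m)
      then have "g (Suc m) * a = (int (Suc m) * e) * a"
        using rec'[of m] \<open>a = b\<close> by (simp add: algebra_simps)
      then show ?case using nz by simp
    qed (simp add: assms)
    from this[of p] have "int p * e = 1" using assms by simp
    then show False using \<open>1 < p\<close> by (metis dvd_triv_left int_dvd_int_iff of_nat_1 nat_dvd_1_iff_1 less_irrefl)
  qed
  \<comment> \<open>The closed form of a geometric sum of ratio \<open>b / a\<close>, multiplied out
    to stay within the integers.\<close>
  have closed: "g m * a ^ m * (b - a) = e * a * (b ^ m - a ^ m)" if "m \<le> p" for m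
    using that
  proof (induction m)
    case (Suc m)
    have "g (Suc m) * a ^ Suc m * (b - a) = (g (Suc m) * a) * a ^ m * (b - a)" by simp
    also have "\<dots> = b * (g m * a ^ m * (b - a)) + e * a * a ^ m * (b - a)"
      using rec'[of m] Suc.prems by (simp add: algebra_simps)
    also have "\<dots> = b * (e * a * (b ^ m - a ^ m)) + e * a * a ^ m * (b - a)"
      using Suc by simp
    finally show ?case by (simp add: algebra_simps)
  qed (simp add: assms)
  define S where "S = (\<Sum>i<p. a ^ (p - Suc i) * b ^ i)"
  have S: "b ^ p - a ^ p = (b - a) * S"
    unfolding S_def using power_diff_sumr2[of b p a] by (simp add: mult.commute)
  have "a ^ p * (b - a) = e * a * S * (b - a)"
    using closed[of p] S assms by (simp add: algebra_simps)
  then have "a ^ p = e * a * S" using \<open>a \<noteq> b\<close> by simp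
  then have "S dvd a ^ p" by simp
  \<comment> \<open>A common divisor of \<open>S\<close> and \<open>a\<close> divides
    \<open>b ^ p\<close>, so it is a unit because \<open>a\<close> and \<open>b\<close> are coprime.
    Since \<open>S\<close> divides \<open>a ^ p\<close>, it is then a unit itself.\<close>
  moreover have "coprime S (a ^ p)"
  proof -
    have "coprime S a"
    proof (rule coprimeI)
      fix q assume q: "q dvd S" "q dvd a"
      then have "q dvd b ^ p - a ^ p" using S by simp
      moreover have "q dvd a ^ p" using q assms by (meson dvd_power dvd_trans zero_less_one less_trans)
      ultimately have "q dvd b ^ p" by (metis diff_add_cancel dvd_add)
      moreover have "coprime q (b ^ p)"
        using q(2) ab(3) by (meson coprime_divisors coprime_power_right_iff dvd_refl)
      ultimately show "is_unit q" by (metis coprime_absorb_left)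
    qed
    then show ?thesis by simp
  qed
  ultimately have "is_unit S" by (metis coprime_absorb_left)
  then have "\<bar>b ^ p - a ^ p\<bar> = \<bar>b - a\<bar>" using S by (simp add: abs_mult)
  then have "b = - a" using abs_power_diff_eq_abs_diff assms nz \<open>a \<noteq> b\<close> by blast
  then show ?thesis using ab by simp
qed

section \<open>Powers in groups with unique roots\<close>

lemma (in group) int_pow_intertwine:
  fixes k :: int
  assumes "x \<in> carrier G" "y \<in> carrier G" "t \<in> carrier G" "x \<otimes> t = t \<otimes> y"
  shows "x [^] k \<otimes> t = t \<otimes> y [^] k"
proof -
  have x: "x = t \<otimes> y \<otimes> inv t" using assms by (simp add: inv_solve_right)
  have nat: "x [^] n \<otimes> t = t \<otimes> y [^] n" for n :: nat
  proof (induction n)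
    case (Suc n)
    have "x [^] Suc n \<otimes> t = x [^] n \<otimes> t \<otimes> y" using assms by (simp add: m_assoc)
    also have "\<dots> = t \<otimes> y [^] Suc n" using Suc assms by (simp add: m_assoc)
    finally show ?case .
  qed (use assms in simp)
  show ?thesis
  proof (cases k)
    case (nonneg n)
    then show ?thesis using nat by (simp add: int_pow_int)
  next
    case (neg n)
    define v w where "v = x [^] Suc n" and "w = y [^] Suc n"
    have vw: "v \<in> carrier G" "w \<in> carrier G" "v \<otimes> t = t \<otimes> w"
      using nat[of "Suc n"] assms by (simp_all add: v_def w_def)
    have "inv v \<otimes> t = inv v \<otimes> (t \<otimes> w) \<otimes> inv w"
      using assms vw by (simp add: m_assoc)
    also have "\<dots> = t \<otimes> inv w"
      using assms vw by (simp flip: vw(3) m_assoc)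
    finally show ?thesis
      using neg assms by (simp add: v_def w_def int_pow_neg_int del: of_nat_Suc nat_pow_Suc)
  qed
qed

lemma unique_rootsD:
  assumes "unique_roots G" "x \<in> carrier G" "y \<in> carrier G" "n > 0" "x [^]\<^bsub>G\<^esub> (n::nat) = y [^]\<^bsub>G\<^esub> n"
  shows "x = y"
  using assms by (auto simp: unique_roots_def)

text \<open>Unique roots exclude torsion, since \<open>c\<close> and \<open>\<one>\<close> would be
  two roots of \<open>\<one>\<close>.\<close>

lemma (in group) unique_roots_int_pow_eq_one:
  assumes ur: "unique_roots G" and c: "c \<in> carrier G" "c \<noteq> \<one>" and "c [^] (k::int) = \<one>"
  shows "k = 0"
proof (rule ccontr)
  assume "k \<noteq> 0"
  have "c [^] nat \<bar>k\<bar> = \<one>"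
  proof (cases k)
    case (nonneg n)
    then show ?thesis using assms(4) by (simp add: int_pow_int)
  next
    case (neg n)
    then have "inv (c [^] Suc n) = \<one>" using assms(4) c by (simp add: int_pow_neg_int del: of_nat_Suc nat_pow_Suc)
    then have "c [^] Suc n = \<one>" using c by (metis inv_inv inv_one nat_pow_closed)
    moreover have "nat \<bar>k\<bar> = Suc n" using neg by simp
    ultimately show ?thesis by (simp only:)
  qed
  then show False
    using unique_rootsD[OF ur c(1) one_closed, of "nat \<bar>k\<bar>"] c \<open>k \<noteq> 0\<close> by simp
qed

lemma (in group) unique_roots_int_pow_inj:
  assumes ur: "unique_roots G" and c: "c \<in> carrier G" "c \<noteq> \<one>" and "c [^] (k::int) = c [^] (l::int)"
  shows "k = l"
proof -
  have "c [^] (k - l) = \<one>" using assms by (simp add: int_pow_diff)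
  then show ?thesis using unique_roots_int_pow_eq_one[OF ur c] by fastforce
qed

text \<open>Put \<open>v = inv c u c\<close>. The hypothesis reads
  \<open>v ^ m = t ^ m c ^ g m\<close>, whence the exponent \<open>g m - 1\<close> and the values
  \<open>g 0 = 0\<close> and \<open>g p = 1\<close>. Comparing consecutive powers shows that
  \<open>t\<close> intertwines powers of \<open>c\<close>, and the exponents obey the recurrence of
  a geometric sum.\<close>

lemma (in group) no_constant_coset_powers:
  fixes g :: "nat \<Rightarrow> int"
  assumes ur: "unique_roots G" and c: "c \<in> carrier G" "c \<noteq> \<one>" and t: "t \<in> carrier G"
    and u: "u \<in> carrier G" and p: "odd p" "1 < p"
    and pow: "\<And>m. m \<le> p \<Longrightarrow> u [^] m = c \<otimes> t [^] m \<otimes> c [^] (g m - 1)"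
    and top: "u [^] p = c \<otimes> t [^] p"
  shows False
proof -
  note inj = unique_roots_int_pow_inj[OF ur c] and order = unique_roots_int_pow_eq_one[OF ur c]
  have g0: "g 0 = 0"
  proof -
    have "c [^] (1 + (g 0 - 1)) = \<one>" unfolding int_pow_mult[OF c(1)] using pow[of 0, symmetric] c by simp
    then show ?thesis using order[of "1 + (g 0 - 1)"] by simp
  qed
  have gp: "g p = 1"
  proof -
    have "c [^] (g p - 1) = \<one>"
      using pow[of p] top c t by (simp add: m_assoc)
    then show ?thesis using order[of "g p - 1"] by simp
  qed
  define e where "e = g 1"
  have u_eq: "u = c \<otimes> t \<otimes> c [^] (e - 1)" using pow[of 1] p u t by (simp add: e_def)
  have step: "c [^] g m \<otimes> t = t \<otimes> c [^] (g (Suc m) - e)" if "m < p" for m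
  proof -
    have cg: "c [^] g m = c [^] (g m - 1) \<otimes> c"
      using int_pow_mult[of c "g m - 1" 1] c by simp
    have "c \<otimes> t [^] m \<otimes> (c [^] g m \<otimes> t \<otimes> c [^] (e - 1)) = c \<otimes> t [^] m \<otimes> c [^] (g m - 1) \<otimes> u"
      using c t by (simp add: u_eq m_assoc cg)
    also have "\<dots> = u [^] Suc m" using pow[of m] that by simp
    also have "\<dots> = c \<otimes> t [^] m \<otimes> (t \<otimes> c [^] (g (Suc m) - 1))"
      using pow[of "Suc m"] that c t by (simp add: m_assoc)
    also have "g (Suc m) - 1 = (g (Suc m) - e) + (e - 1)" by simp
    also have "c \<otimes> t [^] m \<otimes> (t \<otimes> c [^] ((g (Suc m) - e) + (e - 1)))
        = c \<otimes> t [^] m \<otimes> (t \<otimes> c [^] (g (Suc m) - e) \<otimes> c [^] (e - 1))"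
      unfolding int_pow_mult[OF c(1)] using c t by (simp add: m_assoc)
    finally have "c [^] g m \<otimes> t \<otimes> c [^] (e - 1) = t \<otimes> c [^] (g (Suc m) - e) \<otimes> c [^] (e - 1)"
      using c t by (simp del: m_assoc)
    then show ?thesis using c t by simp
  qed
  \<comment> \<open>If \<open>e = 0\<close>, then \<open>u\<close> is conjugate to \<open>t\<close>
    by \<open>c\<close> and every \<open>g m\<close> vanishes, against
    \<open>g p = 1\<close>.\<close>
  have e0: "e \<noteq> 0"
  proof
    assume "e = 0"
    have "g m = 0" if "m \<le> p" for m
      using that
    proof (induction m)
      case (Suc m)
      then show ?case
        using step[of m] \<open>e = 0\<close> c t order[of "g (Suc m)"] r_cancel_one'[of t "c [^] g (Suc m)"] by simp
    qed (rule g0)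
    from this[of p] show False using gp by simp
  qed
  define f where "f = g (Suc 1) - e"
  have ef: "c [^] e \<otimes> t = t \<otimes> c [^] f" using step[of 1] p by (simp add: e_def f_def)
  have f0: "f \<noteq> 0"
  proof
    assume "f = 0"
    then have "c [^] e = \<one>" using ef c t by simp
    then show False using order e0 by blast
  qed
  \<comment> \<open>The element \<open>c ^ (e * g m)\<close> is moved past \<open>t\<close> in two
    ways, as a power of \<open>c ^ e\<close> and as a power of \<open>c ^ g m\<close>. Exponents can
    be compared because \<open>c\<close> has infinite order.\<close>
  have "f * g m = e * (g (Suc m) - e)" if "m < p" for m
  proof -
    have "t \<otimes> c [^] (f * g m) = (c [^] e) [^] g m \<otimes> t"
      using int_pow_intertwine[OF _ _ t ef, of "g m"] c by (simp add: int_pow_pow)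
    also have "\<dots> = (c [^] g m) [^] e \<otimes> t" using c by (simp add: int_pow_pow mult.commute)
    also have "\<dots> = t \<otimes> c [^] ((g (Suc m) - e) * e)"
      using int_pow_intertwine[OF _ _ t step[OF that], of e] c by (simp add: int_pow_pow)
    finally have "c [^] (f * g m) = c [^] ((g (Suc m) - e) * e)" using c t by simp
    from inj[OF this] show ?thesis by (simp add: mult.commute)
  qed
  then have "f = - e"
    using geometric_sum_recurrence[of e f p g] e0 f0 p g0 gp by blast
  then have inv_e: "c [^] e \<otimes> t = t \<otimes> inv (c [^] e)" using ef c by (simp add: int_pow_neg)
  \<comment> \<open>This is the Klein bottle case: \<open>t\<close> inverts \<open>c ^ e\<close>, so
    \<open>c ^ e t\<close> and \<open>t\<close> have the same square.\<close>
  have "(c [^] e \<otimes> t) [^] (2::nat) = (t \<otimes> inv (c [^] e)) \<otimes> (c [^] e \<otimes> t)"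
    using c t by (simp add: numeral_2_eq_2 inv_e[symmetric])
  also have "\<dots> = t [^] (2::nat)"
    using c t by (simp add: numeral_2_eq_2 m_assoc inv_solve_left')
  finally have "c [^] e \<otimes> t = t"
    using unique_rootsD[OF ur _ t, of "c [^] e \<otimes> t" 2] c t by simp
  then have "c [^] e = \<one>" using c t by simp
  then show False using order e0 by blast
qed

lemma (in group) int_hom_pow:
  assumes "h \<in> hom G integer_group" "x \<in> carrier G"
  shows "h (x [^] (n::nat)) = int n * h x" "h (x [^] (k::int)) = k * h x" "h (inv x) = - h x"
proof -
  interpret h: group_hom G integer_group h
    using assms by (simp add: group_hom_def group_hom_axioms_def)
  show "h (x [^] k) = k * h x" for k :: int
    using h.hom_int_pow[OF assms(2), of k] by (simp add: mult.commute)
  from this[of "int n"] show "h (x [^] n) = int n * h x" by (simp add: int_pow_int)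
  show "h (inv x) = - h x" using assms h.hom_inv[of x] by simp
qed

lemma (in group) int_hom_one:
  assumes "h \<in> hom G integer_group"
  shows "h \<one> = 0"
  using hom_one[OF assms is_group] by simp

text \<open>The cocycle \<open>\<delta>\<close> counts signed edges of the Bass--Serre tree, \<open>\<delta> x g\<close> being the coefficient
  at the edge \<open>inverse x C\<close> in the path from the base vertex to its translate by \<open>g\<close>;
  \<open>\<pi>\<close> orders the edges by height. Since \<open>c t ^ p\<close> climbs one edge at each of \<open>p\<close> consecutive
  heights, a \<open>p\<close>-th root climbs a single edge at height 0, which determines the cosets of its powers.\<close>

lemma (in group) twist_not_power:
  fixes p :: nat
  assumes ur: "unique_roots G" and c: "c \<in> carrier G" "c \<noteq> \<one>" and t: "t \<in> carrier G"
    and pi: "\<pi> \<in> hom G integer_group" "\<pi> c = 0" "\<pi> t = 1"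
    and cocycle: "\<And>x g h. x \<in> carrier G \<Longrightarrow> g \<in> carrier G \<Longrightarrow> h \<in> carrier G \<Longrightarrow>
                    \<delta> x (g \<otimes> h) = \<delta> x g + \<delta> (x \<otimes> g) h"
    and delta_c: "\<And>x. x \<in> carrier G \<Longrightarrow> \<delta> x c = 0"
    and delta_t: "\<And>x. x \<in> carrier G \<Longrightarrow> \<delta> x t = (if x \<in> generate G {c} then 1 else (0::int))"
    and bounded: "\<And>x. x \<in> carrier G \<Longrightarrow> \<delta> x u \<noteq> 0 \<Longrightarrow> \<bar>\<pi> x\<bar> \<le> B"
    and p: "odd p" "1 < p" and u: "u \<in> carrier G" and root: "u [^] p = c \<otimes> t [^] p"
  shows False
proof -
  have pi_mult: "\<pi> (x \<otimes> y) = \<pi> x + \<pi> y" if "x \<in> carrier G" "y \<in> carrier G" for x y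
    using hom_mult[OF pi(1) that] by simp
  note pi_simps = pi_mult int_hom_pow[OF pi(1)] int_hom_one[OF pi(1)] pi(2,3)
  have delta_one: "\<delta> x \<one> = 0" if "x \<in> carrier G" for x
    using cocycle[OF that one_closed one_closed] that by simp
  have delta_pow: "\<delta> x (g [^] n) = (\<Sum>i<n. \<delta> (x \<otimes> g [^] i) g)"
    if "x \<in> carrier G" "g \<in> carrier G" for x g and n :: nat
    using that by (induction n) (simp_all add: delta_one cocycle)
  have pi_u: "\<pi> u = 1"
  proof -
    have "int p * \<pi> u = int p * 1"
      using root pi_simps(2)[OF u, of p] c t by (simp add: pi_simps)
    then show ?thesis using p by simp
  qed
  have pi_gen: "\<pi> x = 0" if "x \<in> generate G {c}" for x
    using that c by (auto simp: generate_pow pi_simps)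
  \<comment> \<open>\<open>E x\<close> is \<open>\<delta>\<close> at \<open>u ^ p\<close>, split
    along the powers of \<open>u\<close>. Evaluated through \<open>c t ^ p\<close> it counts the
    \<open>i < p\<close> with \<open>x c t ^ i\<close> in the group generated by \<open>c\<close>,
    so a nonzero value confines the height of \<open>x\<close> to
    \<open>- (p - 1), ..., 0\<close>.\<close>
  define E where "E x = (\<Sum>i<p. \<delta> (x \<otimes> u [^] i) u)" for x
  have E_eq: "E x = (\<Sum>i<p. if x \<otimes> c \<otimes> t [^] i \<in> generate G {c} then 1 else 0)" if x: "x \<in> carrier G" for x
  proof -
    have "E x = \<delta> x (u [^] p)" using x u by (simp add: E_def delta_pow)
    also have "\<dots> = \<delta> (x \<otimes> c) (t [^] p)" using x c t by (simp add: root cocycle delta_c)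
    finally show ?thesis using x c t by (simp add: delta_pow delta_t)
  qed
  have E_nonzero: "\<exists>i<p. x \<otimes> c \<otimes> t [^] i \<in> generate G {c} \<and> \<pi> x = - int i"
    if x: "x \<in> carrier G" and nz: "E x \<noteq> 0" for x
  proof -
    obtain i where i: "i < p" "x \<otimes> c \<otimes> t [^] i \<in> generate G {c}"
      using nz unfolding E_eq[OF x]
      by (rule sum.not_neutral_contains_not_neutral) (auto split: if_splits)
    then have "\<pi> x + int i = 0"
      using pi_gen[OF i(2)] x c t by (simp add: pi_simps)
    then show ?thesis using i by force
  qed
  have E_single: "E x = \<delta> (x \<otimes> u [^] m) u"
    if "m < p" "\<And>i. i < p \<Longrightarrow> i \<noteq> m \<Longrightarrow> \<delta> (x \<otimes> u [^] i) u = 0" for x m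
    unfolding E_def using that by (subst sum.remove[of _ m]) auto
  have E_one: "E \<one> = 1"
  proof -
    have "\<one> \<otimes> c \<otimes> t [^] i \<in> generate G {c} \<longleftrightarrow> i = 0" for i :: nat
      using pi_gen[of "c \<otimes> t [^] i"] c t generate.incl[of c "{c}" G] by (auto simp: pi_simps)
    then show ?thesis using p by (simp add: E_eq)
  qed
  define P where "P = {x \<in> carrier G. \<delta> x u \<noteq> 0}"
  have "\<exists>i<p. \<delta> (\<one> \<otimes> u [^] i) u \<noteq> 0"
    using E_one unfolding E_def by (metis (no_types, lifting) lessThan_iff sum.neutral zero_neq_one)
  then have P_ne: "P \<noteq> {}" using u by (auto simp: P_def)
  have "\<pi> ` P \<subseteq> {- B..B}" using bounded by (force simp: P_def)
  then have fin: "finite (\<pi> ` P)" by (rule finite_subset) simp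
  have zero: "\<delta> x u = 0" if "x \<in> carrier G" "\<pi> x < Min (\<pi> ` P) \<or> \<pi> x > Max (\<pi> ` P)" for x
  proof (rule ccontr)
    assume "\<delta> x u \<noteq> 0"
    then have "\<pi> x \<in> \<pi> ` P" using that by (simp add: P_def)
    then show False using that fin by (meson Max_ge Min_le leD)
  qed
  \<comment> \<open>For \<open>x\<close> of maximal height in \<open>P\<close> the translates
    \<open>x u ^ i\<close> with \<open>i > 0\<close> lie above \<open>P\<close>, so
    \<open>E x\<close> keeps only its first term. That term is nonzero, so the height of
    \<open>x\<close> is at most 0.\<close>
  have max: "Max (\<pi> ` P) \<le> 0"
  proof -
    have "Max (\<pi> ` P) \<in> \<pi> ` P" using fin P_ne by simp
    then obtain x where x: "x \<in> carrier G" "\<delta> x u \<noteq> 0" "\<pi> x = Max (\<pi> ` P)" by (auto simp: P_def)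
    have "E x = \<delta> (x \<otimes> u [^] (0::nat)) u"
      using p x u by (intro E_single zero) (auto simp: pi_simps pi_u)
    then obtain i :: nat where "\<pi> x = - int i" using E_nonzero[of x] x u by auto
    then show ?thesis using x by simp
  qed
  \<comment> \<open>Moving an \<open>x\<close> of minimal height down by \<open>u ^ (p - 1)\<close>
    makes the last term the only survivor. The lower bound \<open>- (p - 1)\<close> for the shifted
    element is the bound 0 for \<open>x\<close>.\<close>
  have min: "0 \<le> Min (\<pi> ` P)"
  proof -
    have "Min (\<pi> ` P) \<in> \<pi> ` P" using fin P_ne by simp
    then obtain x where x: "x \<in> carrier G" "\<delta> x u \<noteq> 0" "\<pi> x = Min (\<pi> ` P)" by (auto simp: P_def)
    define y where "y = x \<otimes> inv (u [^] (p - 1))"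
    have y: "y \<in> carrier G" "y \<otimes> u [^] (p - 1) = x" "\<pi> y = \<pi> x - int (p - 1)"
      using x u by (auto simp: y_def m_assoc pi_simps pi_u)
    have "E y = \<delta> (y \<otimes> u [^] (p - 1)) u"
      using p x y u by (intro E_single zero) (auto simp: pi_simps pi_u)
    then have "E y \<noteq> 0" using x y by simp
    then obtain i where "i < p" "\<pi> y = - int i" using E_nonzero[OF y(1)] by blast
    then show ?thesis using x(3) y(3) p by linarith
  qed
  have level: "\<delta> x u = 0" if "x \<in> carrier G" "\<pi> x \<noteq> 0" for x
    using zero[of x] that max min by linarith
  \<comment> \<open>All of \<open>P\<close> now has height 0, and among the translates of
    \<open>inv (u ^ m)\<close> only \<open>\<one>\<close> has that height.\<close>
  have E_inv: "E (inv (u [^] m)) = \<delta> \<one> u" if "m < p" for m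
  proof -
    have "E (inv (u [^] m)) = \<delta> (inv (u [^] m) \<otimes> u [^] m) u"
      using that u by (intro E_single level) (auto simp: pi_simps pi_u)
    then show ?thesis using u by simp
  qed
  have delta_u: "\<delta> \<one> u = 1" using E_inv[of 0] E_one p by simp
  \<comment> \<open>Nonvanishing of \<open>E\<close> at \<open>inv (u ^ m)\<close> puts
    \<open>inv (u ^ m) c t ^ i\<close> into the group generated by \<open>c\<close>, and comparing
    heights gives \<open>i = m\<close>. The case \<open>m = p\<close> lies outside the range of the
    sum and is the root equation, with \<open>n = 1\<close>.\<close>
  have "\<exists>n::int. u [^] m = c \<otimes> t [^] m \<otimes> c [^] (n - 1)" if m: "m \<le> p" for m
  proof (cases "m = p")
    case True
    then show ?thesis using root c t by (intro exI[of _ 1]) simp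
  next
    case False
    then have "E (inv (u [^] m)) \<noteq> 0" using m E_inv[of m] delta_u by simp
    then obtain i where i: "inv (u [^] m) \<otimes> c \<otimes> t [^] i \<in> generate G {c}" "\<pi> (inv (u [^] m)) = - int i"
      using E_nonzero[of "inv (u [^] m)"] u by auto
    then have "i = m" using u by (simp add: pi_simps pi_u)
    then obtain k :: int where k: "inv (u [^] m) \<otimes> c \<otimes> t [^] m = c [^] k"
      using i c by (auto simp: generate_pow)
    then have "c \<otimes> t [^] m = u [^] m \<otimes> c [^] k"
      using u c t by (simp add: m_assoc inv_solve_left')
    then have "u [^] m = c \<otimes> t [^] m \<otimes> c [^] (- k)"
      using u c t by (simp add: int_pow_neg m_assoc)
    then show ?thesis by (intro exI[of _ "1 - k"]) simp
  qed
  then obtain g :: "nat \<Rightarrow> int" where "\<And>m. m \<le> p \<Longrightarrow> u [^] m = c \<otimes> t [^] m \<otimes> c [^] (g m - 1)"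
    by metis
  then show False using no_constant_coset_powers[OF ur c t u p _ root] by blast
qed

section \<open>The abstract commensurator\<close>

context group
begin

text \<open>A finite cover by cosets can be pushed through a homomorphism and combined along a tower
  of subgroups without counting.\<close>

lemma finite_index_iff_cover:
  "finite_index G H \<longleftrightarrow> subgroup H G \<and> (\<exists>F. finite F \<and> F \<subseteq> carrier G \<and> carrier G \<subseteq> (\<Union>x\<in>F. H #> x))"
proof (cases "subgroup H G")
  case True
  have rcosets_image: "rcosets H = (\<lambda>a. H #> a) ` carrier G" by (auto simp: RCOSETS_def)
  show ?thesis
  proof
    assume "finite_index G H"
    then obtain F where F: "F \<subseteq> carrier G" "finite F" "rcosets H = (\<lambda>a. H #> a) ` F"
      using finite_subset_image[of "rcosets H" "\<lambda>a. H #> a" "carrier G"] rcosets_image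
      by (auto simp: finite_index_def)
    then have "carrier G \<subseteq> (\<Union>x\<in>F. H #> x)"
      using rcosets_part_G[OF True] by auto
    then show "subgroup H G \<and> (\<exists>F. finite F \<and> F \<subseteq> carrier G \<and> carrier G \<subseteq> (\<Union>x\<in>F. H #> x))"
      using F True by blast
  next
    assume "subgroup H G \<and> (\<exists>F. finite F \<and> F \<subseteq> carrier G \<and> carrier G \<subseteq> (\<Union>x\<in>F. H #> x))"
    then obtain F where F: "finite F" "F \<subseteq> carrier G" "carrier G \<subseteq> (\<Union>x\<in>F. H #> x)" by blast
    have "rcosets H \<subseteq> (\<lambda>a. H #> a) ` F"
    proof
      fix R assume "R \<in> rcosets H"
      then obtain a where a: "a \<in> carrier G" "R = H #> a" using rcosets_image by auto
      then obtain x where "x \<in> F" "a \<in> H #> x" using F by auto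
      then show "R \<in> (\<lambda>a. H #> a) ` F"
        using a F True repr_independence[of a H x] by (metis imageI subsetD)
    qed
    then show "finite_index G H"
      using True F finite_subset[of "rcosets H"] by (auto simp: finite_index_def)
  qed
qed (simp add: finite_index_def)

lemma finite_index_subgroup: "finite_index G H \<Longrightarrow> subgroup H G"
  by (simp add: finite_index_def)

lemma finite_index_carrier: "finite_index G (carrier G)"
  unfolding finite_index_iff_cover using subgroup_self
  by (auto intro!: exI[of _ "{\<one>}"] simp: coset_mult_one)

lemma finite_index_Int:
  assumes "finite_index G H" "finite_index G K"
  shows "finite_index G (H \<inter> K)"
proof -
  have sub: "subgroup H G" "subgroup K G" using assms by (auto simp: finite_index_def)
  have "(H \<inter> K) #> a = (H #> a) \<inter> (K #> a)" if "a \<in> carrier G" for a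
    using that subgroup.mem_carrier[OF sub(1)] subgroup.mem_carrier[OF sub(2)]
    by (fastforce simp: r_coset_def)
  then have "rcosets (H \<inter> K) \<subseteq> (\<lambda>(R, S). R \<inter> S) ` ((rcosets H) \<times> (rcosets K))"
    by (fastforce simp: RCOSETS_def)
  then show ?thesis
    using assms finite_subset[of "rcosets (H \<inter> K)"]
    by (auto simp: finite_index_def intro!: subgroups_Inter_pair)
qed

lemma comm_isos_iff:
  "(H, f) \<in> comm_isos G \<longleftrightarrow> finite_index G H \<and> finite_index G (f ` H) \<and>
     (\<forall>x\<in>H. \<forall>y\<in>H. f (x \<otimes> y) = f x \<otimes> f y) \<and> inj_on f H \<and> (\<forall>x. x \<notin> H \<longrightarrow> f x = undefined)"
  by (auto simp: comm_isos_def iso_def hom_def bij_betw_def)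

lemma comm_isos_group_hom:
  assumes "(H, f) \<in> comm_isos G"
  shows "group_hom (G\<lparr>carrier := H\<rparr>) G f"
proof -
  have H: "subgroup H G" and fH: "subgroup (f ` H) G"
    and mult: "\<And>x y. x \<in> H \<Longrightarrow> y \<in> H \<Longrightarrow> f (x \<otimes> y) = f x \<otimes> f y"
    using assms by (auto simp: comm_isos_iff finite_index_def)
  have "f \<in> hom (G\<lparr>carrier := H\<rparr>) G"
    using mult subgroup.mem_carrier[OF fH] by (auto simp: hom_def)
  then show ?thesis
    using subgroup_imp_group[OF H] by (simp add: group_hom_def group_hom_axioms_def is_group)
qed

lemma comm_isos_pow:
  assumes "(H, f) \<in> comm_isos G" "x \<in> H"
  shows "f (x [^] (n::nat)) = f x [^] n"
  using group_hom.hom_nat_pow[OF comm_isos_group_hom[OF assms(1)], of x n] assms(2)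
  by (simp add: nat_pow_consistent[symmetric])

lemma comm_isos_closed:
  assumes "(H, f) \<in> comm_isos G" "x \<in> H"
  shows "f x \<in> carrier G"
  using group_hom.hom_closed[OF comm_isos_group_hom[OF assms(1)]] assms(2) by simp

text \<open>Images of representatives for \<open>K\<close> in \<open>H\<close>, multiplied by
  representatives for the image of \<open>H\<close> in \<open>G\<close>, cover
  \<open>G\<close>.\<close>

lemma finite_index_image:
  assumes p: "(H, f) \<in> comm_isos G" and K: "finite_index G K" "K \<subseteq> H"
  shows "finite_index G (f ` K)"
proof -
  interpret f: group_hom "G\<lparr>carrier := H\<rparr>" G f by (rule comm_isos_group_hom[OF p])
  have H: "subgroup H G" and fH: "finite_index G (f ` H)"
    and mult: "\<And>x y. x \<in> H \<Longrightarrow> y \<in> H \<Longrightarrow> f (x \<otimes> y) = f x \<otimes> f y"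
    using p by (auto simp: comm_isos_iff finite_index_def)
  have subK: "subgroup K G" using K by (simp add: finite_index_def)
  have sub: "subgroup (f ` K) G"
    by (rule f.subgroup_img_is_subgroup[OF subgroup_incl[OF subK H K(2)]])
  have "finite ((\<lambda>a. K #> a) ` H)"
    by (rule finite_subset[of _ "rcosets K"])
      (use K subgroup.mem_carrier[OF H] in \<open>auto simp: finite_index_def RCOSETS_def\<close>)
  then obtain F where F: "F \<subseteq> H" "finite F" "(\<lambda>a. K #> a) ` H = (\<lambda>a. K #> a) ` F"
    using finite_subset_image[of "(\<lambda>a. K #> a) ` H" "\<lambda>a. K #> a" H] by auto
  obtain F' where F': "finite F'" "F' \<subseteq> carrier G" "carrier G \<subseteq> (\<Union>x\<in>F'. f ` H #> x)"
    using fH unfolding finite_index_iff_cover by auto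
  have "carrier G \<subseteq> (\<Union>z\<in>(\<lambda>(x, y). f x \<otimes> y) ` (F \<times> F'). f ` K #> z)"
  proof
    fix g assume "g \<in> carrier G"
    then obtain y h where y: "y \<in> F'" "h \<in> H" "g = f h \<otimes> y" using F' by (auto simp: r_coset_def)
    have "h \<in> K #> h" using rcos_self[OF subgroup.mem_carrier[OF H y(2)] subK] .
    moreover have "K #> h \<in> (\<lambda>a. K #> a) ` F" using F(3) y(2) by blast
    then obtain x where x: "x \<in> F" "K #> h = K #> x" by auto
    ultimately obtain k where k: "k \<in> K" "h = k \<otimes> x" by (auto simp: r_coset_def)
    have "f k \<in> carrier G" "f x \<in> carrier G" "y \<in> carrier G"
      using k x y K F F' comm_isos_closed[OF p] by auto
    moreover have "f h = f k \<otimes> f x" using k x mult[of k x] K F by blast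
    ultimately have "g = f k \<otimes> (f x \<otimes> y)" using y by (simp add: m_assoc)
    then show "g \<in> (\<Union>z\<in>(\<lambda>(x, y). f x \<otimes> y) ` (F \<times> F'). f ` K #> z)"
      using k x y by (auto simp: r_coset_def)
  qed
  moreover have "(\<lambda>(x, y). f x \<otimes> y) ` (F \<times> F') \<subseteq> carrier G"
    using F F' comm_isos_closed[OF p] by (auto simp: subset_iff)
  ultimately show ?thesis
    unfolding finite_index_iff_cover using sub F(2) F'(1)
    by (intro conjI exI[of _ "(\<lambda>(x, y). f x \<otimes> y) ` (F \<times> F')"] finite_imageI finite_cartesian_product)
qed

definition comm_inv :: "('a set \<times> ('a \<Rightarrow> 'a)) \<Rightarrow> ('a set \<times> ('a \<Rightarrow> 'a))" where
  "comm_inv p = (snd p ` fst p, \<lambda>y. if y \<in> snd p ` fst p then inv_into (fst p) (snd p) y else undefined)"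

lemma comm_inv_closed:
  assumes "p \<in> comm_isos G"
  shows "comm_inv p \<in> comm_isos G"
proof -
  obtain H f where [simp]: "p = (H, f)" by (cases p)
  have p: "finite_index G H" "finite_index G (f ` H)" "inj_on f H"
     "\<And>x y. x \<in> H \<Longrightarrow> y \<in> H \<Longrightarrow> f (x \<otimes> y) = f x \<otimes> f y"
    using assms by (auto simp: comm_isos_iff)
  note H = finite_index_subgroup[OF p(1)] and fH = finite_index_subgroup[OF p(2)]
  define f' where "f' = snd (comm_inv p)"
  have inv: "f' (f x) = x" if "x \<in> H" for x
    using p(3) that by (simp add: comm_inv_def f'_def)
  have "f' ` f ` H = H" using inv by force
  moreover have "inj_on f' (f ` H)" using inv by (auto simp: inj_on_def)
  moreover have "f' (u \<otimes> v) = f' u \<otimes> f' v" if uv: "u \<in> f ` H" "v \<in> f ` H" for u v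
  proof -
    obtain x y where "x \<in> H" "y \<in> H" "u = f x" "v = f y" using uv by auto
    then show ?thesis using inv p(4)[of x y] subgroup.m_closed[OF H, of x y] by metis
  qed
  moreover have "comm_inv p = (f ` H, f')" by (simp add: f'_def comm_inv_def)
  moreover have "\<forall>x. x \<notin> f ` H \<longrightarrow> f' x = undefined" by (simp add: f'_def comm_inv_def)
  ultimately show ?thesis using p by (simp add: comm_isos_iff)
qed

text \<open>The preimage is an image under the inverse commensuration, which reduces the claim to
  \<open>finite_index_image\<close>.\<close>

lemma finite_index_preimage:
  assumes p: "(H, f) \<in> comm_isos G" and K: "finite_index G K" "K \<subseteq> H" "finite_index G L"
  shows "finite_index G {x \<in> K. f x \<in> L}"
proof -
  obtain f' where f': "comm_inv (H, f) = (f ` H, f')" by (simp add: comm_inv_def)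
  have inj: "inj_on f H" using p by (simp add: comm_isos_iff)
  have inv: "f' (f x) = x" if "x \<in> H" for x
    using inj that f' by (auto simp: comm_inv_def)
  have "finite_index G (f' ` (f ` K \<inter> L))"
    using finite_index_image[OF comm_inv_closed[OF p, unfolded f'] finite_index_Int[OF finite_index_image[OF p K(1,2)] K(3)]] K
    by auto
  moreover have "f' ` (f ` K \<inter> L) = {x \<in> K. f x \<in> L}" using inv K by force
  ultimately show ?thesis by simp
qed

lemma comm_comp_closed:
  assumes "p \<in> comm_isos G" "q \<in> comm_isos G"
  shows "comm_comp p q \<in> comm_isos G"
proof -
  obtain H f H' f' where [simp]: "p = (H, f)" "q = (H', f')" by (cases p, cases q)
  define K where "K = {x \<in> H. f x \<in> H'}"
  have p: "(H, f) \<in> comm_isos G" and q: "(H', f') \<in> comm_isos G" using assms by auto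
  have H: "finite_index G H" and H': "finite_index G H'" using p q by (auto simp: comm_isos_iff)
  have K: "finite_index G K" "K \<subseteq> H" unfolding K_def using finite_index_preimage[OF p H _ H'] by auto
  have fK: "finite_index G (f ` K)" using finite_index_image[OF p K] .
  have "finite_index G (f' ` f ` K)"
    using finite_index_image[OF q fK] by (auto simp: K_def)
  moreover have "inj_on (\<lambda>x. f' (f x)) K"
    using p q by (fastforce simp: comm_isos_iff K_def inj_on_def)
  ultimately show ?thesis
    using K p q subgroup.m_closed[OF finite_index_subgroup[OF K(1)]]
    by (auto simp: comm_comp_def comm_isos_iff K_def[symmetric] image_image inj_on_def)
       (auto simp: K_def)
qed

lemma comm_equivI:
  assumes "p \<in> comm_isos G" "q \<in> comm_isos G" "finite_index G K"
    "K \<subseteq> fst p" "K \<subseteq> fst q" "\<And>x. x \<in> K \<Longrightarrow> snd p x = snd q x"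
  shows "(p, q) \<in> comm_equiv G"
  using assms unfolding comm_equiv_def by blast

lemma equiv_comm_equiv: "equiv (comm_isos G) (comm_equiv G)"
proof (rule equivI)
  show "refl_on (comm_isos G) (comm_equiv G)"
    by (auto simp: refl_on_def comm_equiv_def comm_isos_iff)
  show "sym (comm_equiv G)"
    by (auto simp: sym_def comm_equiv_def)
  show "trans (comm_equiv G)"
  proof (rule transI)
    fix p q r assume "(p, q) \<in> comm_equiv G" "(q, r) \<in> comm_equiv G"
    then obtain K L where "p \<in> comm_isos G" "r \<in> comm_isos G"
      "finite_index G K" "K \<subseteq> fst p \<inter> fst q" "\<forall>x\<in>K. snd p x = snd q x"
      "finite_index G L" "L \<subseteq> fst q \<inter> fst r" "\<forall>x\<in>L. snd q x = snd r x"
      by (auto simp: comm_equiv_def)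
    then show "(p, r) \<in> comm_equiv G"
      by (intro comm_equivI[of _ _ "K \<inter> L"] finite_index_Int) auto
  qed
  show "comm_equiv G \<subseteq> comm_isos G \<times> comm_isos G" by (auto simp: comm_equiv_def)
qed

lemma comm_comp_cong:
  assumes pp: "(p, p') \<in> comm_equiv G" and qq: "(q, q') \<in> comm_equiv G"
  shows "(comm_comp p q, comm_comp p' q') \<in> comm_equiv G"
proof -
  obtain K where K: "p \<in> comm_isos G" "p' \<in> comm_isos G" "finite_index G K"
      "K \<subseteq> fst p \<inter> fst p'" "\<forall>x\<in>K. snd p x = snd p' x"
    using pp by (auto simp: comm_equiv_def)
  obtain L where L: "q \<in> comm_isos G" "q' \<in> comm_isos G" "finite_index G L"
      "L \<subseteq> fst q \<inter> fst q'" "\<forall>x\<in>L. snd q x = snd q' x"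
    using qq by (auto simp: comm_equiv_def)
  have "finite_index G {x \<in> K. snd p x \<in> L}"
    using finite_index_preimage[of "fst p" "snd p" K L] K L by auto
  then show ?thesis
    using K L by (intro comm_equivI[of _ _ "{x \<in> K. snd p x \<in> L}"] comm_comp_closed)
      (auto simp: comm_comp_def subset_iff)
qed

definition comm_class :: "'a set \<times> ('a \<Rightarrow> 'a) \<Rightarrow> ('a set \<times> ('a \<Rightarrow> 'a)) set" where
  "comm_class p = comm_equiv G `` {p}"

lemma carrier_Comm: "carrier (Comm G) = comm_class ` comm_isos G"
  by (auto simp: Comm_def quotient_def comm_class_def)

lemma comm_class_eq: "(p, q) \<in> comm_equiv G \<Longrightarrow> comm_class p = comm_class q"
  unfolding comm_class_def by (rule equiv_class_eq[OF equiv_comm_equiv])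

text \<open>The product in \<open>Comm G\<close> selects representatives by choice;
  \<open>comm_comp_cong\<close> makes the result independent of the selection.\<close>

lemma comm_class_mult:
  assumes "p \<in> comm_isos G" "q \<in> comm_isos G"
  shows "comm_class p \<otimes>\<^bsub>Comm G\<^esub> comm_class q = comm_class (comm_comp p q)"
proof -
  have some: "(r, SOME r'. r' \<in> comm_class r) \<in> comm_equiv G" if "r \<in> comm_isos G" for r
  proof -
    have "r \<in> comm_class r" using equiv_class_self[OF equiv_comm_equiv that] by (simp add: comm_class_def)
    then have "(SOME r'. r' \<in> comm_class r) \<in> comm_class r" by (rule someI)
    then show ?thesis by (simp add: comm_class_def)
  qed
  show ?thesis
    using comm_class_eq[OF comm_comp_cong[OF some[OF assms(1)] some[OF assms(2)]]]
    by (simp add: Comm_def comm_class_def)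
qed

definition comm_id :: "'a set \<times> ('a \<Rightarrow> 'a)" where
  "comm_id = (carrier G, \<lambda>x. if x \<in> carrier G then x else undefined)"

lemma one_Comm: "\<one>\<^bsub>Comm G\<^esub> = comm_class comm_id"
  by (simp add: Comm_def comm_class_def comm_id_def)

lemma comm_id_closed: "comm_id \<in> comm_isos G"
  by (auto simp: comm_id_def comm_isos_iff finite_index_carrier inj_on_def)

lemma group_Comm: "group (Comm G)"
proof (rule groupI)
  show "\<one>\<^bsub>Comm G\<^esub> \<in> carrier (Comm G)"
    by (simp add: one_Comm carrier_Comm comm_id_closed)
next
  fix U V assume "U \<in> carrier (Comm G)" "V \<in> carrier (Comm G)"
  then show "U \<otimes>\<^bsub>Comm G\<^esub> V \<in> carrier (Comm G)"
    by (auto simp: carrier_Comm comm_class_mult comm_comp_closed)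
next
  fix U V W assume "U \<in> carrier (Comm G)" "V \<in> carrier (Comm G)" "W \<in> carrier (Comm G)"
  then obtain p q r where *: "p \<in> comm_isos G" "q \<in> comm_isos G" "r \<in> comm_isos G"
    "U = comm_class p" "V = comm_class q" "W = comm_class r"
    by (auto simp: carrier_Comm)
  have "comm_comp (comm_comp p q) r = comm_comp p (comm_comp q r)"
    by (auto simp: comm_comp_def Let_def fun_eq_iff)
  then show "U \<otimes>\<^bsub>Comm G\<^esub> V \<otimes>\<^bsub>Comm G\<^esub> W = U \<otimes>\<^bsub>Comm G\<^esub> (V \<otimes>\<^bsub>Comm G\<^esub> W)"
    using * by (simp add: comm_class_mult comm_comp_closed)
next
  fix U assume "U \<in> carrier (Comm G)"
  then obtain p where p: "p \<in> comm_isos G" "U = comm_class p" by (auto simp: carrier_Comm)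
  have fin: "finite_index G (fst p)" using p(1) by (cases p) (simp add: comm_isos_iff)
  note sub = fin subgroup.subset[OF finite_index_subgroup[OF fin]]
  have "(comm_comp comm_id p, p) \<in> comm_equiv G"
    using sub p by (intro comm_equivI[of _ _ "fst p"] comm_comp_closed comm_id_closed)
      (auto simp: comm_comp_def comm_id_def)
  then show "\<one>\<^bsub>Comm G\<^esub> \<otimes>\<^bsub>Comm G\<^esub> U = U"
    using p by (simp add: one_Comm comm_class_mult comm_id_closed comm_class_eq)
  let ?K = "snd p ` fst p"
  have K: "finite_index G ?K" and inj: "inj_on (snd p) (fst p)"
    using p(1) by (cases p, auto simp: comm_isos_iff)+
  have "(comm_comp (comm_inv p) p, comm_id) \<in> comm_equiv G"
    using K inj p subgroup.subset[OF finite_index_subgroup[OF K]]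
    by (intro comm_equivI[of _ _ ?K] comm_comp_closed comm_inv_closed comm_id_closed)
      (auto simp: comm_comp_def comm_inv_def comm_id_def)
  then show "\<exists>V\<in>carrier (Comm G). V \<otimes>\<^bsub>Comm G\<^esub> U = \<one>\<^bsub>Comm G\<^esub>"
    using p comm_inv_closed[OF p(1)]
    by (intro bexI[of _ "comm_class (comm_inv p)"])
      (auto simp: one_Comm comm_class_mult comm_class_eq carrier_Comm)
qed

end

section \<open>Powers with exponent prime to \<open>p\<close> under commensurations\<close>

context group
begin

text \<open>For a group with unique roots this says that \<open>f\<close>, extended to rational powers, maps some power of
  \<open>g\<close> with exponent prime to \<open>p\<close> into \<open>G\<close>. Passing to \<open>g ^ (k * m)\<close> makes the condition
  independent of the representative of a commensuration.\<close>

definition prime_to_power_preserving :: "nat \<Rightarrow> 'a set \<times> ('a \<Rightarrow> 'a) \<Rightarrow> bool" where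
  "prime_to_power_preserving p r \<longleftrightarrow>
     (\<forall>g\<in>carrier G. \<exists>k h m. coprime k p \<and> h \<in> carrier G \<and> m > 0 \<and>
        g [^] (k * m :: nat) \<in> fst r \<and> snd r (g [^] (k * m)) = h [^] m)"

text \<open>Pigeonhole on the cosets of \<open>g ^ 0, ..., g ^ n\<close>, with \<open>n\<close> the
  index. The bound matters: a positive exponent at most \<open>n\<close> is prime to every prime
  above \<open>n\<close>.\<close>

lemma finite_index_pow_mem:
  assumes H: "finite_index G H" and g: "g \<in> carrier G"
  obtains k :: nat where "k > 0" "k \<le> card (rcosets H)" "g [^] k \<in> H"
proof -
  have sub: "subgroup H G" and fin: "finite (rcosets H)" using H by (auto simp: finite_index_def)
  have "(\<lambda>j::nat. H #> g [^] j) ` {..card (rcosets H)} \<subseteq> rcosets H"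
    using g rcosetsI[OF subgroup.subset[OF sub]] by auto
  then have "card ((\<lambda>j::nat. H #> g [^] j) ` {..card (rcosets H)}) < card {..card (rcosets H)}"
    using card_mono[OF fin] by (metis card_atMost le_imp_less_Suc)
  then have "\<not> inj_on (\<lambda>j::nat. H #> g [^] j) {..card (rcosets H)}"
    by (rule pigeonhole)
  then obtain a b :: nat where ab: "a \<noteq> b" "a \<le> card (rcosets H)" "b \<le> card (rcosets H)"
      "H #> g [^] a = H #> g [^] b"
    by (auto simp: inj_on_def)
  define l k where "l = min a b" and "k = max a b - l"
  have eq: "H #> g [^] (k + l) = H #> g [^] l" "k > 0" "k \<le> card (rcosets H)"
    using ab by (auto simp: l_def k_def min_def max_def)
  have "g [^] k \<otimes> g [^] l \<in> H #> g [^] l"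
    using rcos_self[of "g [^] (k + l)" H] g sub eq(1) by (simp add: nat_pow_mult)
  then obtain h where "h \<in> H" "g [^] k \<otimes> g [^] l = h \<otimes> g [^] l" by (auto simp: r_coset_def)
  then have "g [^] k \<in> H" using g subgroup.mem_carrier[OF sub] by auto
  then show thesis using eq that by blast
qed

text \<open>A further power \<open>n\<close> reaches a subgroup where both representatives agree; it
  is absorbed into \<open>m\<close>, and \<open>k\<close> is unchanged.\<close>

lemma prime_to_power_preserving_equiv:
  assumes eq: "(r, r') \<in> comm_equiv G" and r: "prime_to_power_preserving p r"
  shows "prime_to_power_preserving p r'"
  unfolding prime_to_power_preserving_def
proof
  fix g assume g: "g \<in> carrier G"
  obtain K where K: "r \<in> comm_isos G" "finite_index G K"
      "K \<subseteq> fst r \<inter> fst r'" "\<And>x. x \<in> K \<Longrightarrow> snd r x = snd r' x"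
    using eq by (auto simp: comm_equiv_def)
  obtain k h m where *: "coprime k p" "h \<in> carrier G" "m > 0"
      "g [^] (k * m) \<in> fst r" "snd r (g [^] (k * m)) = h [^] m"
    using r g unfolding prime_to_power_preserving_def by blast
  obtain n :: nat where n: "n > 0" "(g [^] (k * m)) [^] n \<in> K"
    using finite_index_pow_mem[OF K(2), of "g [^] (k * m)"] g by auto
  have pow: "(g [^] (k * m)) [^] n = g [^] (k * (m * n))" using g by (simp add: nat_pow_pow mult.assoc)
  have "snd r' (g [^] (k * (m * n))) = snd r ((g [^] (k * m)) [^] n)" using K(4)[OF n(2)] pow by simp
  also have "\<dots> = h [^] (m * n)"
    using comm_isos_pow[of "fst r" "snd r" "g [^] (k * m)" n] K(1) * by (simp add: nat_pow_pow)
  finally show "\<exists>k h m. coprime k p \<and> h \<in> carrier G \<and> m > 0 \<and>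
        g [^] (k * m) \<in> fst r' \<and> snd r' (g [^] (k * m)) = h [^] m"
    using * n K(3) pow by (intro exI[of _ k] exI[of _ h] exI[of _ "m * n"]) auto
qed

lemma prime_to_power_preserving_comp:
  assumes q: "q \<in> comm_isos G" and r: "r \<in> comm_isos G"
    and "prime_to_power_preserving p q" "prime_to_power_preserving p r"
  shows "prime_to_power_preserving p (comm_comp q r)"
  unfolding prime_to_power_preserving_def
proof
  fix g assume g: "g \<in> carrier G"
  obtain k h m where *: "coprime k p" "h \<in> carrier G" "m > 0"
      "g [^] (k * m) \<in> fst q" "snd q (g [^] (k * m)) = h [^] m"
    using assms(3) g unfolding prime_to_power_preserving_def by blast
  obtain l h' n where **: "coprime l p" "h' \<in> carrier G" "n > 0"
      "h [^] (l * n) \<in> fst r" "snd r (h [^] (l * n)) = h' [^] n"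
    using assms(4) *(2) unfolding prime_to_power_preserving_def by blast
  have sub: "subgroup (fst q) G" "subgroup (fst r) G"
    using q r by (cases q, cases r, auto simp: comm_isos_iff finite_index_subgroup)+
  have pow: "g [^] (k * l * (m * n)) = (g [^] (k * m)) [^] (l * n)"
    using g by (simp add: nat_pow_pow mult_ac)
  have mem: "g [^] (k * l * (m * n)) \<in> fst q"
    unfolding pow using subgroup_int_pow_closed[OF sub(1) *(4), of "int (l * n)"] unfolding int_pow_int .
  have "snd q (g [^] (k * l * (m * n))) = (h [^] m) [^] (l * n)"
    unfolding pow using comm_isos_pow[of "fst q" "snd q"] q * by simp
  also have "\<dots> = (h [^] (l * n)) [^] m" using * by (simp add: nat_pow_pow mult_ac)
  finally have img: "snd q (g [^] (k * l * (m * n))) = (h [^] (l * n)) [^] m" .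
  have "(h [^] (l * n)) [^] m \<in> fst r" 
    using subgroup_int_pow_closed[OF sub(2) **(4), of "int m"] by (simp add: int_pow_int)
  moreover have "snd r ((h [^] (l * n)) [^] m) = h' [^] (m * n)"
    using comm_isos_pow[of "fst r" "snd r"] r ** by (simp add: nat_pow_pow mult.commute)
  ultimately show "\<exists>k h m. coprime k p \<and> h \<in> carrier G \<and> m > 0 \<and>
        g [^] (k * m) \<in> fst (comm_comp q r) \<and> snd (comm_comp q r) (g [^] (k * m)) = h [^] m"
    using * ** mem img
    by (intro exI[of _ "k * l"] exI[of _ h'] exI[of _ "m * n"]) (simp add: comm_comp_def Let_def)
qed

lemma prime_to_power_preserving_index:
  assumes r: "r \<in> comm_isos G" and p: "Factorial_Ring.prime p" "card (rcosets (fst r)) < p"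
  shows "prime_to_power_preserving p r"
  unfolding prime_to_power_preserving_def
proof
  fix g assume g: "g \<in> carrier G"
  have "finite_index G (fst r)" using r by (cases r) (simp add: comm_isos_iff)
  then obtain k :: nat where k: "k > 0" "k \<le> card (rcosets (fst r))" "g [^] k \<in> fst r"
    using finite_index_pow_mem g by blast
  have "\<not> p dvd k" using k p by (auto dest: dvd_imp_le)
  then have "coprime k p" using p(1) by (metis coprime_commute prime_imp_coprime)
  then show "\<exists>k h m. coprime k p \<and> h \<in> carrier G \<and> m > 0 \<and>
        g [^] (k * m) \<in> fst r \<and> snd r (g [^] (k * m)) = h [^] m"
    using k comm_isos_closed[of "fst r" "snd r" "g [^] k"] r
    by (intro exI[of _ k] exI[of _ "snd r (g [^] k)"] exI[of _ 1]) simp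
qed

lemma finitely_generated_Comm_imp_prime_to_power_preserving:
  assumes "finitely_generated_group (Comm G)"
  obtains N where "\<And>p r. Factorial_Ring.prime p \<Longrightarrow> N < p \<Longrightarrow> r \<in> comm_isos G \<Longrightarrow> prime_to_power_preserving p r"
proof -
  interpret Comm: group "Comm G" by (rule group_Comm)
  obtain S where S: "finite S" "S \<subseteq> carrier (Comm G)" "generate (Comm G) S = carrier (Comm G)"
    using assms by (auto simp: finitely_generated_group_def)
  \<comment> \<open>Inverses of generators get representatives of their own and enter
    \<open>N\<close> too, so they are good by the index bound rather than by an inversion
    argument.\<close>
  define S' where "S' = S \<union> (\<lambda>U. inv\<^bsub>Comm G\<^esub> U) ` S"
  have S': "finite S'" "S' \<subseteq> carrier (Comm G)" using S by (auto simp: S'_def)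
  have "\<exists>r\<in>comm_isos G. U = comm_class r" if "U \<in> S'" for U
    using S' that by (auto simp: carrier_Comm)
  then obtain rep where rep: "\<And>U. U \<in> S' \<Longrightarrow> rep U \<in> comm_isos G \<and> U = comm_class (rep U)" by metis
  define N where "N = (\<Sum>U\<in>S'. card (rcosets (fst (rep U))))"
  have "prime_to_power_preserving p r" if p: "Factorial_Ring.prime p" "N < p" and r: "r \<in> comm_isos G" for p r
  proof -
    have S'_good: "\<exists>q\<in>comm_isos G. U = comm_class q \<and> prime_to_power_preserving p q" if "U \<in> S'" for U
    proof -
      have "card (rcosets (fst (rep U))) \<le> N"
        unfolding N_def using S'(1) that by (intro member_le_sum) auto
      then show ?thesis
        using rep[OF that] prime_to_power_preserving_index[of "rep U" p] p by auto
    qed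
    have "\<exists>q\<in>comm_isos G. U = comm_class q \<and> prime_to_power_preserving p q"
      if "U \<in> generate (Comm G) S" for U
      using that
    proof induction
      case one
      have "prime_to_power_preserving p comm_id"
        unfolding prime_to_power_preserving_def comm_id_def
        by (intro ballI exI[of _ 1] exI[of _ "_ :: 'a"] conjI) auto
      then show ?case using one_Comm comm_id_closed by blast
    next
      case (incl U)
      then show ?case using S'_good[of U] by (simp add: S'_def)
    next
      case (inv U)
      then show ?case using S'_good[of "inv\<^bsub>Comm G\<^esub> U"] by (simp add: S'_def)
    next
      case (eng U V)
      then obtain q q' where "q \<in> comm_isos G" "U = comm_class q" "prime_to_power_preserving p q"
        "q' \<in> comm_isos G" "V = comm_class q'" "prime_to_power_preserving p q'" by blast
      then show ?case
        using comm_class_mult comm_comp_closed prime_to_power_preserving_comp by metis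
    qed
    moreover have "comm_class r \<in> generate (Comm G) S" using S(3) r by (auto simp: carrier_Comm)
    ultimately obtain q where "q \<in> comm_isos G" "comm_class r = comm_class q" "prime_to_power_preserving p q"
      by blast
    moreover have "(q, r) \<in> comm_equiv G"
      using eq_equiv_class[OF _ equiv_comm_equiv, of q r] r calculation(2) by (simp add: comm_class_def)
    ultimately show ?thesis using prime_to_power_preserving_equiv by blast
  qed
  then show thesis using that by blast
qed

end

section \<open>Dehn twists\<close>

text \<open>By the cocycle law \<open>z x (inv h)\<close> is the inverse of
  \<open>z (act x (inv h)) h\<close>, so values propagate from generators only when all base points
  are treated together. Identities between twists thereby reduce to checks on \<open>A\<close> and
  \<open>t\<close>.\<close>

lemma cocycle_unique:
  assumes "group K" "group G" and sub: "S \<subseteq> carrier G"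
    and act: "\<And>x. act x \<one>\<^bsub>G\<^esub> = x"
    and z: "\<And>x g. g \<in> carrier G \<Longrightarrow> z x g \<in> carrier K"
      "\<And>x g h. g \<in> carrier G \<Longrightarrow> h \<in> carrier G \<Longrightarrow> z x (g \<otimes>\<^bsub>G\<^esub> h) = z x g \<otimes>\<^bsub>K\<^esub> z (act x g) h"
    and z': "\<And>x g. g \<in> carrier G \<Longrightarrow> z' x g \<in> carrier K"
      "\<And>x g h. g \<in> carrier G \<Longrightarrow> h \<in> carrier G \<Longrightarrow> z' x (g \<otimes>\<^bsub>G\<^esub> h) = z' x g \<otimes>\<^bsub>K\<^esub> z' (act x g) h"
    and eq: "\<And>x s. s \<in> S \<Longrightarrow> z x s = z' x s"
    and g: "g \<in> generate G S"
  shows "z x g = z' x g"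
proof -
  interpret K: group K by fact
  interpret G: group G by fact
  have unit: "w x \<one>\<^bsub>G\<^esub> = \<one>\<^bsub>K\<^esub>"
    if "\<And>x g. g \<in> carrier G \<Longrightarrow> w x g \<in> carrier K"
      "\<And>x g h. g \<in> carrier G \<Longrightarrow> h \<in> carrier G \<Longrightarrow> w x (g \<otimes>\<^bsub>G\<^esub> h) = w x g \<otimes>\<^bsub>K\<^esub> w (act x g) h"
    for w x
    using that(2)[of "\<one>\<^bsub>G\<^esub>" "\<one>\<^bsub>G\<^esub>" x] that(1)[of "\<one>\<^bsub>G\<^esub>" x] act by simp
  have inverse: "w x (inv\<^bsub>G\<^esub> h) = inv\<^bsub>K\<^esub> (w (act x (inv\<^bsub>G\<^esub> h)) h)"
    if w: "\<And>x g. g \<in> carrier G \<Longrightarrow> w x g \<in> carrier K"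
      "\<And>x g h. g \<in> carrier G \<Longrightarrow> h \<in> carrier G \<Longrightarrow> w x (g \<otimes>\<^bsub>G\<^esub> h) = w x g \<otimes>\<^bsub>K\<^esub> w (act x g) h"
      and h: "h \<in> carrier G" for w x h
  proof (rule K.inv_equality[symmetric])
    show "w x (inv\<^bsub>G\<^esub> h) \<otimes>\<^bsub>K\<^esub> w (act x (inv\<^bsub>G\<^esub> h)) h = \<one>\<^bsub>K\<^esub>"
      using w(2)[of "inv\<^bsub>G\<^esub> h" h x] unit[OF w] h by simp
  qed (use w(1) h in auto)
  from g show ?thesis
  proof (induction arbitrary: x)
    case one
    show ?case using unit[OF z] unit[OF z'] by simp
  next
    case (inv h)
    then have "h \<in> carrier G" using sub by blast
    then show ?case using inverse[OF z] inverse[OF z'] eq[OF inv.hyps] by simp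
  next
    case (eng g h)
    then have "g \<in> carrier G" "h \<in> carrier G"
      using G.generate_in_carrier[OF sub] by auto
    then show ?case using z(2) z'(2) eng.IH by simp
  qed (rule eq)
qed

section \<open>Edge counts and twists in a cyclic HNN extension\<close>

locale cyclic_HNN =
  fixes A :: "('a, 'b) monoid_scheme" and C D phi and G :: "('g, 'c) monoid_scheme" (structure)
    and i t a and \<pi> :: "'g \<Rightarrow> int"
  assumes hnn: "is_HNN A C D phi G i t" and a: "a \<in> carrier A" and C: "C = generate A {a}"
    and \<pi>: "\<pi> \<in> hom G integer_group" and \<pi>_base: "\<And>x. x \<in> carrier A \<Longrightarrow> \<pi> (i x) = 0"
    and \<pi>_t: "\<pi> t = 1"

sublocale cyclic_HNN \<subseteq> group G
  using hnn by (simp add: is_HNN_def)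

context cyclic_HNN
begin

abbreviation c where "c \<equiv> i a"

lemma group_base: "group A" using hnn by (simp add: is_HNN_def)

lemma t_closed [simp]: "t \<in> carrier G" using hnn by (simp add: is_HNN_def)

lemma i_hom: "i \<in> hom A G" using hnn by (simp add: is_HNN_def)

lemma i_closed [simp]: "x \<in> carrier A \<Longrightarrow> i x \<in> carrier G"
  using i_hom by (rule hom_in_carrier)

lemma c_closed [simp]: "c \<in> carrier G" using a by simp

lemma gens: "i ` carrier A \<union> {t} \<subseteq> carrier G" "generate G (i ` carrier A \<union> {t}) = carrier G"
  using hnn by (auto simp: is_HNN_def)

lemma C_subset: "x \<in> C \<Longrightarrow> x \<in> carrier A"
  using hnn subgroup.mem_carrier by (fastforce simp: is_HNN_def)

lemma phi_closed: "x \<in> C \<Longrightarrow> phi x \<in> carrier A"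
proof -
  have "phi \<in> iso (A\<lparr>carrier := C\<rparr>) (A\<lparr>carrier := D\<rparr>)" "subgroup D A"
    using hnn by (auto simp: is_HNN_def)
  then show "x \<in> C \<Longrightarrow> phi x \<in> carrier A"
    using subgroup.mem_carrier[of D A] by (auto simp: iso_def hom_def)
qed

lemma image_C: "i ` C = generate G {c}"
proof -
  interpret i: group_hom A G i
    using i_hom group_base by (simp add: group_hom_def group_hom_axioms_def is_group)
  show ?thesis using i.generate_img[of "{a}"] a by (simp add: C)
qed

lemma C_t: "x \<in> C \<Longrightarrow> i x \<otimes> t = t \<otimes> i (phi x)"
proof -
  assume x: "x \<in> C"
  then have "inv t \<otimes> i x \<otimes> t = i (phi x)" using hnn by (simp add: is_HNN_def)
  then show ?thesis
    using C_subset[OF x] phi_closed[OF x] by (simp add: m_assoc inv_solve_left')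
qed

lemma \<pi>_mult: "x \<in> carrier G \<Longrightarrow> y \<in> carrier G \<Longrightarrow> \<pi> (x \<otimes> y) = \<pi> x + \<pi> y"
  using hom_mult[OF \<pi>] by simp

lemmas \<pi>_simps = \<pi>_mult int_hom_pow[OF \<pi>] int_hom_one[OF \<pi>] \<pi>_base \<pi>_t

text \<open>\<open>A\<close> fixes the base vertex and \<open>t\<close> crosses the base edge once;
  this prescribes 0 on \<open>A\<close> and, on \<open>t\<close>, the indicator of the group
  generated by \<open>c\<close>. The relation for \<open>t\<close> holds because this indicator is
  invariant under right multiplication by that group. The height bound spreads from the generators,
  where only height 0 occurs.\<close>

lemma edge_cocycle:
  obtains \<delta> :: "'g \<Rightarrow> 'g \<Rightarrow> int"
    where "\<And>x g h. x \<in> carrier G \<Longrightarrow> g \<in> carrier G \<Longrightarrow> h \<in> carrier G \<Longrightarrow>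
             \<delta> x (g \<otimes> h) = \<delta> x g + \<delta> (x \<otimes> g) h"
      and "\<And>x. x \<in> carrier G \<Longrightarrow> \<delta> x c = 0"
      and "\<And>x. x \<in> carrier G \<Longrightarrow> \<delta> x t = (if x \<in> generate G {c} then 1 else 0)"
      and "\<And>g. g \<in> carrier G \<Longrightarrow> \<exists>B. \<forall>x\<in>carrier G. \<delta> x g \<noteq> 0 \<longrightarrow> \<bar>\<pi> x\<bar> \<le> B"
proof -
  \<comment> \<open>Right multiplication fixes everything outside the carrier, because
    \<open>HNN_cocycle\<close> takes an action on a whole type.\<close>
  define act where "act x g = (if x \<in> carrier G then x \<otimes> g else x)" for x g
  define s :: "'g \<Rightarrow> int" where "s x = (if x \<in> generate G {c} then 1 else 0)" for x
  have sub: "subgroup (generate G {c}) G" using generate_is_subgroup by simp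
  have s_C: "s (act x (i k)) = s x" if k: "k \<in> C" for x k
  proof -
    have k': "i k \<in> generate G {c}" using image_C k by blast
    have "x \<otimes> i k \<in> generate G {c} \<longleftrightarrow> x \<in> generate G {c}" if x: "x \<in> carrier G"
    proof
      assume "x \<otimes> i k \<in> generate G {c}"
      then have "x \<otimes> i k \<otimes> inv (i k) \<in> generate G {c}"
        using k' subgroup.m_closed[OF sub] subgroup.m_inv_closed[OF sub] by blast
      then show "x \<in> generate G {c}" using x C_subset[OF k] by (simp add: m_assoc)
    qed (use k' subgroup.m_closed[OF sub] in blast)
    then show ?thesis by (simp add: s_def act_def)
  qed
  obtain \<delta> where d: "\<And>x g h. g \<in> carrier G \<Longrightarrow> h \<in> carrier G \<Longrightarrow> \<delta> x (g \<otimes> h) = \<delta> x g + \<delta> (act x g) h"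
    "\<And>x k. k \<in> carrier A \<Longrightarrow> \<delta> x (i k) = 0" "\<And>x. \<delta> x t = s x"
  proof (rule HNN_cocycle[OF hnn group_integer_group, of act "\<lambda>_ _. 0" s])
    show "act x (g \<otimes> h) = act (act x g) h" if "g \<in> carrier G" "h \<in> carrier G" for x g h
      using that by (simp add: act_def m_assoc)
  qed (auto simp: act_def[of _ \<one>] s_C)
  have cocycle: "\<delta> x (g \<otimes> h) = \<delta> x g + \<delta> (x \<otimes> g) h"
    if "x \<in> carrier G" "g \<in> carrier G" "h \<in> carrier G" for x g h
    using d(1) that by (simp add: act_def)
  have delta_one: "\<delta> x \<one> = 0" if "x \<in> carrier G" for x
    using cocycle[OF that one_closed one_closed] that by simp
  have "\<exists>B. \<forall>x\<in>carrier G. \<delta> x g \<noteq> 0 \<longrightarrow> \<bar>\<pi> x\<bar> \<le> B" if "g \<in> carrier G" for g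
  proof -
    have bound: "\<forall>x\<in>carrier G. \<delta> x g \<noteq> 0 \<longrightarrow> \<bar>\<pi> x\<bar> \<le> 0" if "g \<in> i ` carrier A \<union> {t}" for g
      using that d(2,3) by (auto simp: s_def generate_pow \<pi>_simps a split: if_splits)
    have "g \<in> generate G (i ` carrier A \<union> {t})" using gens(2) that by simp
    then show ?thesis
    proof induction
      case one
      show ?case using delta_one by simp
    next
      case (incl g)
      then show ?case using bound[of g] by blast
    next
      case (inv g)
      then have g: "g \<in> carrier G" using gens(1) by blast
      show ?case
      proof (intro exI ballI impI)
        fix x assume x: "x \<in> carrier G" "\<delta> x (inv g) \<noteq> 0"
        then have "\<delta> (x \<otimes> inv g) g \<noteq> 0"
          using cocycle[of x "inv g" g] g delta_one[of x] by simp
        then have "\<bar>\<pi> (x \<otimes> inv g)\<bar> \<le> 0" using bound[OF inv.hyps] x g by blast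
        then show "\<bar>\<pi> x\<bar> \<le> \<bar>\<pi> g\<bar>" using x g by (simp add: \<pi>_simps)
      qed
    next
      case (eng g h)
      then have gh: "g \<in> carrier G" "h \<in> carrier G" using gens by auto
      obtain B B' where B: "\<forall>x\<in>carrier G. \<delta> x g \<noteq> 0 \<longrightarrow> \<bar>\<pi> x\<bar> \<le> B"
          "\<forall>x\<in>carrier G. \<delta> x h \<noteq> 0 \<longrightarrow> \<bar>\<pi> x\<bar> \<le> B'"
        using eng.IH by blast
      show ?case
      proof (intro exI ballI impI)
        fix x assume x: "x \<in> carrier G" "\<delta> x (g \<otimes> h) \<noteq> 0"
        then have "\<delta> x g \<noteq> 0 \<or> \<delta> (x \<otimes> g) h \<noteq> 0" using cocycle gh by fastforce
        then have "\<bar>\<pi> x\<bar> \<le> B \<or> \<bar>\<pi> (x \<otimes> g)\<bar> \<le> B'" using B x gh by blast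
        then show "\<bar>\<pi> x\<bar> \<le> \<bar>B\<bar> + \<bar>B'\<bar> + \<bar>\<pi> g\<bar>" using x gh by (auto simp: \<pi>_simps)
      qed
    qed
  qed
  then show thesis
    using that[of \<delta>] cocycle d(2)[OF a] d(3) by (simp add: s_def)
qed

text \<open>\<open>e j\<close> is the amount of twisting along edges at height \<open>j\<close>.
  Every choice respects the relation for \<open>t\<close>, since the inserted power of
  \<open>c\<close> commutes with the cyclic image of \<open>C\<close>.\<close>

lemma twist_cocycle:
  fixes e :: "int \<Rightarrow> int"
  obtains \<sigma> where "\<And>j g. g \<in> carrier G \<Longrightarrow> \<sigma> j g \<in> carrier G"
    and "\<And>j g h. g \<in> carrier G \<Longrightarrow> h \<in> carrier G \<Longrightarrow> \<sigma> j (g \<otimes> h) = \<sigma> j g \<otimes> \<sigma> (j + \<pi> g) h"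
    and "\<And>j x. x \<in> carrier A \<Longrightarrow> \<sigma> j (i x) = i x"
    and "\<And>j. \<sigma> j t = c [^] e j \<otimes> t"
proof (rule HNN_cocycle[OF hnn is_group, of "\<lambda>j g. j + \<pi> g" "\<lambda>_ x. i x" "\<lambda>j. c [^] e j \<otimes> t"])
  fix j :: int and k assume k: "k \<in> C"
  then obtain n :: int where n: "i k = c [^] n"
    using image_C by (auto simp: generate_pow a)
  have "i k \<otimes> (c [^] e (j + \<pi> (i k)) \<otimes> t) = c [^] (n + e j) \<otimes> t"
    using C_subset[OF k] n by (simp add: \<pi>_simps int_pow_mult a m_assoc)
  also have "\<dots> = c [^] e j \<otimes> (i k \<otimes> t)"
    using C_subset[OF k] n by (simp add: int_pow_mult a m_assoc add.commute[of n])
  also have "\<dots> = c [^] e j \<otimes> t \<otimes> i (phi k)"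
    using C_t[OF k] phi_closed[OF k] by (simp add: m_assoc a)
  finally show "i k \<otimes> (c [^] e (j + \<pi> (i k)) \<otimes> t) = c [^] e j \<otimes> t \<otimes> i (phi k)" .
qed (auto simp: \<pi>_simps hom_mult[OF i_hom] a)

end

context cyclic_HNN
begin

text \<open>When the twisting depends only on the height modulo \<open>p\<close>, the cocycle law at
  base point 0 becomes multiplicativity as soon as the first factor has height divisible by
  \<open>p\<close>.\<close>

lemma twist_automorphism:
  assumes p: "p > 0"
  obtains f where "bij_betw f {g \<in> carrier G. int p dvd \<pi> g} {g \<in> carrier G. int p dvd \<pi> g}"
    and "\<And>g h. \<lbrakk>g \<in> carrier G; int p dvd \<pi> g; h \<in> carrier G\<rbrakk> \<Longrightarrow> f (g \<otimes> h) = f g \<otimes> f h"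
    and "f (t [^] p) = c \<otimes> t [^] p"
proof -
  \<comment> \<open>The amount \<open>s\<close> sits on one residue class of heights, that is on one
    of the \<open>p\<close> edges of the cycle. A family in \<open>s\<close> is chosen because the
    inverse of the twist by 1 is the twist by -1.\<close>
  define e where "e s j = (if int p dvd j then s else 0)" for s j :: int
  define P where "P s z \<longleftrightarrow> (\<forall>j g. g \<in> carrier G \<longrightarrow> z j g \<in> carrier G \<and>
      (\<forall>h\<in>carrier G. z j (g \<otimes> h) = z j g \<otimes> z (j + \<pi> g) h) \<and>
      (\<forall>x\<in>carrier A. z j (i x) = i x) \<and> z j t = c [^] e s j \<otimes> t)" for s z
  have "\<forall>s. \<exists>z. P s z"
  proof
    fix s
    obtain z where "\<And>j g. g \<in> carrier G \<Longrightarrow> z j g \<in> carrier G"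
      "\<And>j g h. g \<in> carrier G \<Longrightarrow> h \<in> carrier G \<Longrightarrow> z j (g \<otimes> h) = z j g \<otimes> z (j + \<pi> g) h"
      "\<And>j x. x \<in> carrier A \<Longrightarrow> z j (i x) = i x" "\<And>j. z j t = c [^] e s j \<otimes> t"
      using twist_cocycle[of "e s"] by blast
    then have "P s z" by (simp add: P_def)
    then show "\<exists>z. P s z" by blast
  qed
  then obtain \<sigma> where "\<forall>s. P s (\<sigma> s)" using choice by blast
  then have \<sigma>_closed: "\<And>s j g. g \<in> carrier G \<Longrightarrow> \<sigma> s j g \<in> carrier G"
    and \<sigma>_mult: "\<And>s j g h. g \<in> carrier G \<Longrightarrow> h \<in> carrier G \<Longrightarrow> \<sigma> s j (g \<otimes> h) = \<sigma> s j g \<otimes> \<sigma> s (j + \<pi> g) h"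
    and \<sigma>_base: "\<And>s j x. x \<in> carrier A \<Longrightarrow> \<sigma> s j (i x) = i x"
    and \<sigma>_t: "\<And>s j. \<sigma> s j t = c [^] e s j \<otimes> t"
    unfolding P_def using t_closed by blast+
  note gen = cocycle_unique[OF _ is_group gens(1), unfolded gens(2)]
  have pi_\<sigma>: "\<pi> (\<sigma> s j g) = \<pi> g" if "g \<in> carrier G" for s j g
  proof (rule gen[OF group_integer_group, of "\<lambda>j g. j + \<pi> g" "\<lambda>j g. \<pi> (\<sigma> s j g)" "\<lambda>_. \<pi>"])
    show "\<pi> (\<sigma> s j g) = \<pi> g" if "g \<in> i ` carrier A \<union> {t}" for j g
      using that by (auto simp: \<sigma>_base \<sigma>_t \<pi>_simps a)
  qed (simp_all add: \<sigma>_closed \<sigma>_mult \<pi>_simps that)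
  have periodic: "\<sigma> s (j + n) g = \<sigma> s j g" if n: "int p dvd n" and "g \<in> carrier G" for s j n g
  proof (rule gen[OF is_group, of "\<lambda>j g. j + \<pi> g" "\<lambda>j g. \<sigma> s (j + n) g" "\<sigma> s"])
    have "e s (j + n) = e s j" for j using n by (simp add: e_def dvd_add_left_iff)
    then show "\<sigma> s (j + n) g = \<sigma> s j g" if "g \<in> i ` carrier A \<union> {t}" for j g
      using that by (auto simp: \<sigma>_base \<sigma>_t)
    show "\<sigma> s (j + n) (g \<otimes> h) = \<sigma> s (j + n) g \<otimes> \<sigma> s (j + \<pi> g + n) h"
      if "g \<in> carrier G" "h \<in> carrier G" for j g h
      using \<sigma>_mult[OF that, of s "j + n"] by (simp add: add_ac)
  qed (simp_all add: \<sigma>_closed \<sigma>_mult \<pi>_simps that)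
  \<comment> \<open>The composite obeys the cocycle law because twists preserve heights, by
    \<open>pi_\<sigma>\<close>; on \<open>t\<close> the exponents \<open>e s j\<close> and
    \<open>e (- s) j\<close> cancel.\<close>
  have cancel: "\<sigma> (- s) j (\<sigma> s j g) = g" if "g \<in> carrier G" for s j g
  proof (rule gen[OF is_group, of "\<lambda>j g. j + \<pi> g" "\<lambda>j g. \<sigma> (- s) j (\<sigma> s j g)" "\<lambda>_ g. g"])
    have sc: "\<sigma> (- s) j (c [^] (k::int)) = c [^] k" for j k
    proof -
      have "c [^] k \<in> i ` C" using image_C by (auto simp: generate_pow a)
      then show ?thesis using \<sigma>_base C_subset by auto
    qed
    show "\<sigma> (- s) j (\<sigma> s j g) = g" if "g \<in> i ` carrier A \<union> {t}" for j g
      using that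
    proof
      assume "g \<in> {t}"
      then have "\<sigma> (- s) j (\<sigma> s j g) = \<sigma> (- s) j (c [^] e s j \<otimes> t)" by (simp add: \<sigma>_t)
      also have "\<dots> = c [^] e s j \<otimes> (c [^] e (- s) j \<otimes> t)"
        using a by (simp add: \<sigma>_mult sc \<sigma>_t \<pi>_simps)
      also have "\<dots> = c [^] (e s j + e (- s) j) \<otimes> t" using a by (simp add: int_pow_mult m_assoc)
      also have "e s j + e (- s) j = 0" by (simp add: e_def)
      finally show ?thesis using \<open>g \<in> {t}\<close> by simp
    next
      assume "g \<in> i ` carrier A"
      then show ?thesis using \<sigma>_base by auto
    qed
  qed (simp_all add: \<sigma>_closed \<sigma>_mult pi_\<sigma> \<pi>_simps that)
  show thesis
  proof
    show "bij_betw (\<sigma> 1 0) {g \<in> carrier G. int p dvd \<pi> g} {g \<in> carrier G. int p dvd \<pi> g}"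
      by (rule bij_betw_byWitness[of _ "\<sigma> (- 1) 0"])
        (use cancel[of _ 1 0] cancel[of _ "- 1" 0] in \<open>auto simp: pi_\<sigma> \<sigma>_closed\<close>)
    show "\<sigma> 1 0 (g \<otimes> h) = \<sigma> 1 0 g \<otimes> \<sigma> 1 0 h"
      if "g \<in> carrier G" "int p dvd \<pi> g" "h \<in> carrier G" for g h
      using \<sigma>_mult[OF that(1,3), of 1 0] periodic[OF that(2,3), of 1 0] by simp
    \<comment> \<open>The letters of \<open>t ^ p\<close> are read at heights
      \<open>0, ..., p - 1\<close>, and only the first is divisible by \<open>p\<close>. So a single
      \<open>c\<close> is inserted, in front.\<close>
    have pow: "\<sigma> 1 0 (t [^] Suc n) = c \<otimes> t [^] Suc n" if "n < p" for n
      using that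
    proof (induction n)
      case 0
      then show ?case using a by (simp add: \<sigma>_t e_def)
    next
      case (Suc n)
      have "\<not> int p dvd int (Suc n)" using Suc.prems by (simp only: int_dvd_int_iff) (auto dest: dvd_imp_le)
      then have "\<sigma> 1 (int (Suc n)) t = t" using a by (simp add: \<sigma>_t e_def)
      moreover have "\<sigma> 1 0 (t [^] Suc n \<otimes> t) = \<sigma> 1 0 (t [^] Suc n) \<otimes> \<sigma> 1 (int (Suc n)) t"
        using \<sigma>_mult[of "t [^] Suc n" t 1 0] \<pi>_simps(2)[OF t_closed, of "Suc n"]
        by (simp add: \<pi>_t del: nat_pow_Suc of_nat_Suc)
      ultimately have "\<sigma> 1 0 (t [^] Suc n \<otimes> t) = c \<otimes> t [^] Suc n \<otimes> t" using Suc by (simp del: nat_pow_Suc)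
      then show ?case using a by (simp add: m_assoc)
    qed
    show "\<sigma> 1 0 (t [^] p) = c \<otimes> t [^] p" using pow[of "p - 1"] p by simp
  qed
qed

section \<open>The contradiction for large primes\<close>

lemma finite_index_height_multiple:
  assumes p: "p > 0"
  shows "finite_index G {g \<in> carrier G. int p dvd \<pi> g}" (is "finite_index G ?H")
  unfolding finite_index_iff_cover
proof (intro conjI exI)
  show "subgroup ?H G"
    by (rule subgroupI) (use \<pi>_simps in auto)
  show "carrier G \<subseteq> (\<Union>x\<in>(\<lambda>j::nat. t [^] j) ` {..<p}. ?H #> x)"
  proof
    fix g assume g: "g \<in> carrier G"
    define j where "j = nat (\<pi> g mod int p)"
    have j: "int j = \<pi> g mod int p" "j < p" using p by (auto simp: j_def nat_less_iff)
    have "int p dvd \<pi> (g \<otimes> inv (t [^] j))"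
      using g j by (simp add: \<pi>_simps)
    then have "g \<in> ?H #> t [^] j"
      using g by (auto simp: r_coset_def m_assoc intro!: exI[of _ "g \<otimes> inv (t [^] j)"])
    then show "g \<in> (\<Union>x\<in>(\<lambda>j::nat. t [^] j) ` {..<p}. ?H #> x)" using j by blast
  qed
qed auto

text \<open>Conjugation by \<open>h\<close> fixes \<open>h ^ p = x ^ k\<close>, hence also its
  unique \<open>k\<close>-th root \<open>x\<close>. So \<open>x\<close> and \<open>h\<close>
  commute, and Bezout coefficients \<open>r k + s p = 1\<close> give the root
  \<open>h ^ r x ^ s\<close>.\<close>

lemma pow_root_of_coprime_pow:
  assumes ur: "unique_roots G" and x: "x \<in> carrier G" and h: "h \<in> carrier G"
    and kp: "coprime k p" "k > 0" and eq: "x [^] (k::nat) = h [^] (p::nat)"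
  obtains u where "u \<in> carrier G" "u [^] p = x"
proof -
  have "inv h \<otimes> x \<otimes> h = x"
  proof (rule unique_rootsD[OF ur _ x \<open>k > 0\<close>])
    have conj: "(inv h \<otimes> x \<otimes> h) [^] n = inv h \<otimes> x [^] n \<otimes> h" for n :: nat
    proof -
      have "x \<otimes> h = h \<otimes> (inv h \<otimes> x \<otimes> h)" using x h by (simp flip: m_assoc)
      then have "x [^] n \<otimes> h = h \<otimes> (inv h \<otimes> x \<otimes> h) [^] n"
        using int_pow_intertwine[of x "inv h \<otimes> x \<otimes> h" h "int n"] x h by (simp add: int_pow_int)
      then show ?thesis using x h by (simp add: m_assoc inv_solve_left)
    qed
    have "inv h \<otimes> h [^] p \<otimes> h = h [^] p"
      using h by (metis inv_solve_left m_assoc nat_pow_Suc nat_pow_Suc2 nat_pow_closed inv_closed)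
    then show "(inv h \<otimes> x \<otimes> h) [^] k = x [^] k" using conj eq by simp
  qed (use x h in auto)
  then have comm: "x \<otimes> h = h \<otimes> x" using x h by (metis inv_solve_left m_assoc m_closed inv_closed)
  obtain r s :: int where rs: "r * int k + s * int p = 1"
    using kp(1) bezout_int[of "int k" "int p"] by (auto simp: coprime_iff_gcd_eq_1)
  define u where "u = h [^] r \<otimes> x [^] s"
  have u: "u \<in> carrier G" using h x by (simp add: u_def)
  have hx: "h [^] r \<otimes> x [^] s = x [^] s \<otimes> h [^] r"
    using int_pow_intertwine[of h h "x [^] s" r] int_pow_intertwine[of x x h s] comm h x by simp
  have "u [^] int p = (h [^] r) [^] int p \<otimes> (x [^] s) [^] int p"
    unfolding u_def using hx h x by (intro int_pow_mult_distrib) auto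
  also have "(h [^] r) [^] int p = (h [^] int p) [^] r"
    using h by (simp add: int_pow_pow mult.commute)
  also have "h [^] int p = x [^] int k" using eq by (simp add: int_pow_int)
  also have "(x [^] int k) [^] r = x [^] (r * int k)"
    using x by (simp add: int_pow_pow mult.commute)
  also have "(x [^] s) [^] int p = x [^] (s * int p)" using x by (simp add: int_pow_pow)
  also have "x [^] (r * int k) \<otimes> x [^] (s * int p) = x"
    using x rs by (simp flip: int_pow_mult)
  finally have "u [^] p = x" by (simp add: int_pow_int)
  then show thesis using that u by blast
qed

lemma not_finitely_generated_Comm:
  assumes ur: "unique_roots G" and c1: "c \<noteq> \<one>"
  shows "\<not> finitely_generated_group (Comm G)"
proof
  assume "finitely_generated_group (Comm G)"
  then obtain N where N: "\<And>p r. Factorial_Ring.prime p \<Longrightarrow> N < p \<Longrightarrow> r \<in> comm_isos G \<Longrightarrow> prime_to_power_preserving p r"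
    using finitely_generated_Comm_imp_prime_to_power_preserving by blast
  \<comment> \<open>The bound 2 makes \<open>p\<close> odd, as \<open>twist_not_power\<close>
    requires.\<close>
  obtain p where p: "Factorial_Ring.prime p" "max N 2 < p" using bigger_prime by blast
  then have p': "p > 0" "odd p" "1 < p" "N < p" by (auto simp: prime_odd_nat)
  let ?H = "{g \<in> carrier G. int p dvd \<pi> g}"
  obtain f where f: "bij_betw f ?H ?H"
      "\<And>g h. \<lbrakk>g \<in> carrier G; int p dvd \<pi> g; h \<in> carrier G\<rbrakk> \<Longrightarrow> f (g \<otimes> h) = f g \<otimes> f h"
      "f (t [^] p) = c \<otimes> t [^] p"
    using twist_automorphism[OF p'(1)] by blast
  define f' where "f' g = (if g \<in> ?H then f g else undefined)" for g
  note fin = finite_index_height_multiple[OF p'(1)]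
  have img: "f' ` ?H = ?H" "inj_on f' ?H"
    using f(1) by (auto simp: bij_betw_def f'_def inj_on_def)
  have r: "(?H, f') \<in> comm_isos G"
    unfolding comm_isos_iff img(1)
    using fin img(2) f(2) subgroup.m_closed[OF finite_index_subgroup[OF fin]]
    by (auto simp: f'_def)
  have tp: "t [^] p \<in> ?H" "f' (t [^] p) = c \<otimes> t [^] p"
    using f(3) by (auto simp: f'_def \<pi>_simps)
  obtain k h m where *: "coprime k p" "h \<in> carrier G" "m > 0"
      "t [^] (k * m) \<in> ?H" "f' (t [^] (k * m)) = h [^] m"
    using N[OF p(1) p'(4) r] t_closed unfolding prime_to_power_preserving_def fst_conv snd_conv by blast
  have "k > 0" using *(1) p' by (cases k) auto
  \<comment> \<open>The value of \<open>f'\<close> at \<open>t ^ (p * k * m)\<close> is computed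
    with the exponent grouped in two ways. Uniqueness of \<open>m\<close>-th roots then removes the
    auxiliary \<open>m\<close>.\<close>
  have "(c \<otimes> t [^] p) [^] (k * m) = f' ((t [^] p) [^] (k * m))"
    using comm_isos_pow[OF r tp(1)] tp(2) by simp
  also have "(t [^] p) [^] (k * m) = (t [^] (k * m)) [^] p"
    by (simp add: nat_pow_pow mult.commute)
  also have "f' \<dots> = (h [^] m) [^] p" using comm_isos_pow[OF r *(4)] *(5) by simp
  finally have "((c \<otimes> t [^] p) [^] k) [^] m = (h [^] p) [^] m"
    using a *(2) by (simp add: nat_pow_pow mult.commute)
  then have "(c \<otimes> t [^] p) [^] k = h [^] p" (is "?x [^] k = _")
    using unique_rootsD[OF ur _ _ *(3)] a *(2) by simp
  then obtain u where u: "u \<in> carrier G" "u [^] p = c \<otimes> t [^] p"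
    using pow_root_of_coprime_pow[OF ur, of ?x h k p] * \<open>k > 0\<close> a by auto
  obtain \<delta> :: "'g \<Rightarrow> 'g \<Rightarrow> int"
    where d: "\<And>x g h. x \<in> carrier G \<Longrightarrow> g \<in> carrier G \<Longrightarrow> h \<in> carrier G \<Longrightarrow>
             \<delta> x (g \<otimes> h) = \<delta> x g + \<delta> (x \<otimes> g) h"
      "\<And>x. x \<in> carrier G \<Longrightarrow> \<delta> x c = 0"
      "\<And>x. x \<in> carrier G \<Longrightarrow> \<delta> x t = (if x \<in> generate G {c} then 1 else 0)"
      "\<And>g. g \<in> carrier G \<Longrightarrow> \<exists>B. \<forall>x\<in>carrier G. \<delta> x g \<noteq> 0 \<longrightarrow> \<bar>\<pi> x\<bar> \<le> B"
    using edge_cocycle by blast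
  obtain B where "\<forall>x\<in>carrier G. \<delta> x u \<noteq> 0 \<longrightarrow> \<bar>\<pi> x\<bar> \<le> B" using d(4)[OF u(1)] by blast
  then show False
    using twist_not_power[OF ur _ c1 t_closed \<pi> _ \<pi>_t d(1-3) _ p'(2,3) u, of B] a \<pi>_base by auto
qed

end

theorem theorem4p2:
  fixes A :: "('a, 'b) monoid_scheme" and G :: "('g, 'c) monoid_scheme"
  assumes "group A"
    and "infinite_cyclic_subgroup C A" and "infinite_cyclic_subgroup D A"
    and "phi \<in> iso (A\<lparr>carrier := C\<rparr>) (A\<lparr>carrier := D\<rparr>)"
    and "is_HNN A C D phi G i t"
    and "unique_roots G"
  shows "\<not> finitely_generated_group (Comm G)"
proof -
  interpret A: group A by fact
  obtain a where a: "a \<in> carrier A" "C = generate A {a}" "infinite C" and C: "subgroup C A"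
    using assms(2) by (auto simp: infinite_cyclic_subgroup_def)
  have "a \<noteq> \<one>\<^bsub>A\<^esub>" using a A.generate_one by auto
  moreover have "infinite (carrier A)"
    using a(3) subgroup.subset[OF C] finite_subset by blast
  ultimately have ia: "i a \<noteq> \<one>\<^bsub>G\<^esub>" using HNN_base_injective[OF assms(5) _ a(1)] by blast
  \<comment> \<open>The integers, with \<open>A\<close> sent to 0 and \<open>t\<close> to 1, satisfy
    the relation for \<open>t\<close> trivially; this provides the height.\<close>
  obtain \<pi> where "\<pi> \<in> hom G integer_group" "\<And>x. x \<in> carrier A \<Longrightarrow> \<pi> (i x) = 0" "\<pi> t = 1"
    by (rule HNN_universal[OF assms(5) group_integer_group, of "\<lambda>_. 0" 1]) (auto simp: hom_def)
  then interpret cyclic_HNN A C D phi G i t a \<pi>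
    using assms(5) a by unfold_locales
  show ?thesis using not_finitely_generated_Comm[OF assms(6) ia] .
qed

end
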